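(* Let $M$ be a smooth manifold and let $\mathfrak{a}\subset\mathcal{E}(M)$ be a Łojasiewicz ideal. Then: - the Łojasiewicz radical of $\mathfrak{a}$ is analytic-like, i.e. $\widetilde{\sqrt[\text{Ł}]{\mathfrak{a}}}=\overline{\sqrt[\text{Ł}]{\mathfrak{a}}}$; - $\mathcal{I}(\mathcal{Z}(\mathfrak{a}))=\overline{\sqrt[\text{Ł}]{\mathfrak{a}}}$.
   Context: $\mathcal{E}(M)$ is the algebra of real-valued $C^\infty$ functions on the smooth manifold $M$, with the $C^\infty$ compact-open topology (uniform convergence on compact sets of all derivatives); $\overline{\mathfrak{b}}$ denotes the closure of an ideal $\mathfrak{b}$ in this topology. By Whitney's spectral theorem, $\overline{\mathfrak{b}}=\mathfrak{b}^*:=\{g\in\mathcal{E}(M): T_xg\in T_x\mathfrak{b}\ \forall x\in M\}$, where $T_x$ denotes the Taylor series at $x$. $\mathcal{E}_x$ is the ring of germs at $x$ of smooth functions and $g_x$ is the germ of $g$ at $x$. The saturation of an ideal $\mathfrak{b}\subset\mathcal{E}(M)$ is $\widetilde{\mathfrak{b}}=\{g\in\mathcal{E}(M): g_x\in\mathfrak{b}\mathcal{E}_x\ \forall x\in M\}$. An ideal $\mathfrak{b}$ is called analytic-like if $\mathfrak{b}^*=\widetilde{\mathfrak{b}}$. The Łojasiewicz radical of $\mathfrak{a}$ is the ideal $\sqrt[\text{Ł}]{\mathfrak{a}}=\{g\in\mathcal{E}(M):\exists f\in\mathfrak{a},\ \exists m\ge 1\text{ integer with } f-g^{2m}\ge 0\text{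 on }M\}$. $\mathcal{Z}(\mathfrak{a})$ is the common zero set of $\mathfrak{a}$ in $M$, and $\mathcal{I}(X)$ is the ideal of all $g\in\mathcal{E}(M)$ vanishing on $X\subset M$. Fix a distance $d$ on $M$ inducing its topology and locally equivalent to the Euclidean distance in charts; $d(x,X)=\inf_{y\in X}d(x,y)$, with the convention $d(x,\varnothing)=1$. An ideal $\mathfrak{a}\subset\mathcal{E}(M)$ is a Łojasiewicz ideal if (i) it is generated by finitely many smooth functions, and (ii) it contains an element $f$ such that for every compact $K\subset M$ there are a constant $c>0$ and a positive integer $m$ with $|f(x)|\ge c\,d(x,\mathcal{Z}(\mathfrak{a}))^m$ for all $x$ in an open neighborhood of $K$. *)

theory Defs
  imports "HOL-Analysis.Analysis" "HOL-Algebra.Ideal"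
begin

text \<open>
  A smooth manifold is given by a Hausdorff, second countable topological space (the whole type
  \<open>'a\<close>) and a smooth atlas \<open>A\<close> of charts \<open>(U, \<phi>)\<close>. The charts take values in a linear subspace \<open>V\<close>
  of a Euclidean space, so that the dimension of the manifold is \<open>dim V\<close>, which may be any natural
  number, 0 included.
\<close>

type_synonym ('a, 'b) chart = "'a set \<times> ('a \<Rightarrow> 'b)"

definition dir_deriv ::
    "'b::real_normed_vector \<Rightarrow> ('b \<Rightarrow> 'c::real_normed_vector) \<Rightarrow> 'b \<Rightarrow> 'c" where
  "dir_deriv v F p = vector_derivative (\<lambda>t. F (p + t *\<^sub>R v)) (at 0)"

primrec iter_deriv ::
    "'b::real_normed_vector list \<Rightarrow> ('b \<Rightarrow> 'c::real_normed_vector) \<Rightarrow> 'b \<Rightarrow> 'c" where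
  "iter_deriv [] F = F"
| "iter_deriv (v # vs) F = dir_deriv v (iter_deriv vs F)"

text \<open>
  \<open>C\<^sup>\<infinity>\<close> functions on a relatively open subset \<open>\<Omega>\<close> of \<open>V\<close>: all iterated directional
  derivatives along \<open>V\<close> exist and are continuous. They depend only on the values on \<open>\<Omega>\<close>.
\<close>

definition smooth_on ::
    "'b::euclidean_space set \<Rightarrow> 'b set \<Rightarrow> ('b \<Rightarrow> 'c::real_normed_vector) \<Rightarrow> bool" where
  "smooth_on V \<Omega> F \<longleftrightarrow>
     (\<forall>vs\<in>lists V. continuous_on \<Omega> (iter_deriv vs F) \<and>
        (\<forall>v\<in>V. \<forall>p\<in>\<Omega>. (\<lambda>t. iter_deriv vs F (p + t *\<^sub>R v)) differentiable (at 0)))"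

definition smooth_atlas ::
    "'b::euclidean_space set \<Rightarrow> ('a::topological_space, 'b) chart set \<Rightarrow> bool" where
  "smooth_atlas V A \<longleftrightarrow>
     subspace V \<and>
     (\<Union>(U, \<phi>)\<in>A. U) = UNIV \<and>
     (\<forall>(U, \<phi>)\<in>A. open U \<and> openin (top_of_set V) (\<phi> ` U) \<and>
        homeomorphism U (\<phi> ` U) \<phi> (inv_into U \<phi>)) \<and>
     (\<forall>(U, \<phi>)\<in>A. \<forall>(W, \<psi>)\<in>A. smooth_on V (\<phi> ` (U \<inter> W)) (\<psi> \<circ> inv_into U \<phi>))"

text \<open>The metric is locally bi-Lipschitz equivalent to the Euclidean one in every chart.\<close>

definition locally_euclidean_dist :: "('a::metric_space, 'b::euclidean_space) chart set \<Rightarrow> bool" where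
  "locally_euclidean_dist A \<longleftrightarrow>
     (\<forall>(U, \<phi>)\<in>A. \<forall>p\<in>U. \<exists>W C. open W \<and> p \<in> W \<and> W \<subseteq> U \<and> C > 0 \<and>
        (\<forall>x\<in>W. \<forall>y\<in>W. dist (\<phi> x) (\<phi> y) \<le> C * dist x y \<and> dist x y \<le> C * dist (\<phi> x) (\<phi> y)))"

definition smooth_fun_on ::
    "'b::euclidean_space set \<Rightarrow> ('a, 'b) chart set \<Rightarrow> 'a set \<Rightarrow> ('a \<Rightarrow> real) \<Rightarrow> bool" where
  "smooth_fun_on V A N f \<longleftrightarrow> (\<forall>(U, \<phi>)\<in>A. smooth_on V (\<phi> ` (U \<inter> N)) (f \<circ> inv_into U \<phi>))"

definition smooth_ring ::
    "'b::euclidean_space set \<Rightarrow> ('a, 'b) chart set \<Rightarrow> ('a \<Rightarrow> real) ring" where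
  "smooth_ring V A =
     \<lparr>carrier = {f. smooth_fun_on V A UNIV f},
      mult = (\<lambda>f g x. f x * g x), one = (\<lambda>x. 1),
      zero = (\<lambda>x. 0), add = (\<lambda>f g x. f x + g x)\<rparr>"

definition germ :: "'a::topological_space \<Rightarrow> ('a \<Rightarrow> real) \<Rightarrow> ('a \<Rightarrow> real) set" where
  "germ x f = {h. eventually (\<lambda>y. h y = f y) (nhds x)}"

definition germ_ring ::
    "'b::euclidean_space set \<Rightarrow> ('a::topological_space, 'b) chart set \<Rightarrow> 'a \<Rightarrow>
      ('a \<Rightarrow> real) set ring" where
  "germ_ring V A x =
     \<lparr>carrier = {germ x f | f. \<exists>N. open N \<and> x \<in> N \<and> smooth_fun_on V A N f},
      mult = (\<lambda>F G. {h. \<exists>f\<in>F. \<exists>g\<in>G. eventually (\<lambda>y. h y = f y * g y) (nhds x)}),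
      one = germ x (\<lambda>y. 1),
      zero = germ x (\<lambda>y. 0),
      add = (\<lambda>F G. {h. \<exists>f\<in>F. \<exists>g\<in>G. eventually (\<lambda>y. h y = f y + g y) (nhds x)})\<rparr>"

definition saturation ::
    "'b::euclidean_space set \<Rightarrow> ('a::topological_space, 'b) chart set \<Rightarrow>
      ('a \<Rightarrow> real) set \<Rightarrow> ('a \<Rightarrow> real) set" where
  "saturation V A \<bb> =
     {g \<in> carrier (smooth_ring V A). \<forall>x. germ x g \<in> genideal (germ_ring V A x) (germ x ` \<bb>)}"

text \<open>
  The Taylor series of \<open>g\<close> at \<open>x\<close> in the chart \<open>(U, \<phi>)\<close>, as a formal power series on \<open>V\<close> given by the
  sequence of its homogeneous components \<open>v \<mapsto> D\<^sup>k(g \<circ> \<phi>\<^sup>-\<^sup>1)(\<phi> x)(v, \<dots>, v) / k!\<close>.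
\<close>

definition taylor ::
    "'b::euclidean_space set \<Rightarrow> ('a, 'b) chart \<Rightarrow> 'a \<Rightarrow> ('a \<Rightarrow> real) \<Rightarrow> nat \<Rightarrow> 'b \<Rightarrow> real" where
  "taylor V c x g =
     (case c of (U, \<phi>) \<Rightarrow>
       (\<lambda>k. restrict (\<lambda>v. iter_deriv (replicate k v) (g \<circ> inv_into U \<phi>) (\<phi> x) / fact k) V))"

definition whitney_closure ::
    "'b::euclidean_space set \<Rightarrow> ('a, 'b) chart set \<Rightarrow> ('a \<Rightarrow> real) set \<Rightarrow> ('a \<Rightarrow> real) set" where
  "whitney_closure V A \<bb> =
     {g \<in> carrier (smooth_ring V A).
        \<forall>x. \<forall>c\<in>A. x \<in> fst c \<longrightarrow> taylor V c x g \<in> taylor V c x ` \<bb>}"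

definition analytic_like ::
    "'b::euclidean_space set \<Rightarrow> ('a::topological_space, 'b) chart set \<Rightarrow>
      ('a \<Rightarrow> real) set \<Rightarrow> bool" where
  "analytic_like V A \<bb> \<longleftrightarrow>
     ideal \<bb> (smooth_ring V A) \<and> whitney_closure V A \<bb> = saturation V A \<bb>"

text \<open>
  The \<open>C\<^sup>\<infinity>\<close> compact-open topology: uniform convergence of all derivatives on compact subsets of
  chart domains.
\<close>

definition smooth_topology ::
    "'b::euclidean_space set \<Rightarrow> ('a::topological_space, 'b) chart set \<Rightarrow> ('a \<Rightarrow> real) topology" where
  "smooth_topology V A = topology_generated_by
     {{g \<in> carrier (smooth_ring V A). \<forall>x\<in>K.
         \<bar>iter_deriv vs (g \<circ> inv_into U \<phi>) (\<phi> x) - iter_deriv vs (f \<circ> inv_into U \<phi>) (\<phi> x)\<bar> < \<epsilon>}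
      | f U \<phi> K vs \<epsilon>.
        f \<in> carrier (smooth_ring V A) \<and> (U, \<phi>) \<in> A \<and> compact K \<and> K \<subseteq> U \<and> vs \<in> lists V \<and> \<epsilon> > 0}"

definition loj_radical ::
    "'b::euclidean_space set \<Rightarrow> ('a, 'b) chart set \<Rightarrow> ('a \<Rightarrow> real) set \<Rightarrow> ('a \<Rightarrow> real) set" where
  "loj_radical V A \<aa> =
     {g \<in> carrier (smooth_ring V A). \<exists>f\<in>\<aa>. \<exists>m::nat. m \<ge> 1 \<and> (\<forall>x. f x - g x ^ (2 * m) \<ge> 0)}"

definition zero_set :: "('a \<Rightarrow> real) set \<Rightarrow> 'a set" where
  "zero_set \<aa> = {x. \<forall>f\<in>\<aa>. f x = 0}"

definition vanishing_ideal ::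
    "'b::euclidean_space set \<Rightarrow> ('a, 'b) chart set \<Rightarrow> 'a set \<Rightarrow> ('a \<Rightarrow> real) set" where
  "vanishing_ideal V A X = {g \<in> carrier (smooth_ring V A). \<forall>x\<in>X. g x = 0}"

text \<open>The distance to the empty set is 1 here, whereas \<^const>\<open>infdist\<close> makes it 0.\<close>

definition dist_to :: "'a::metric_space \<Rightarrow> 'a set \<Rightarrow> real" where
  "dist_to x X = (if X = {} then 1 else infdist x X)"

definition lojasiewicz_ideal ::
    "'b::euclidean_space set \<Rightarrow> ('a::metric_space, 'b) chart set \<Rightarrow> ('a \<Rightarrow> real) set \<Rightarrow> bool" where
  "lojasiewicz_ideal V A \<aa> \<longleftrightarrow>
     ideal \<aa> (smooth_ring V A) \<and>
     (\<exists>S. finite S \<and> S \<subseteq> carrier (smooth_ring V A) \<and> \<aa> = genideal (smooth_ring V A) S) \<and>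
     (\<exists>f\<in>\<aa>. \<forall>K. compact K \<longrightarrow>
        (\<exists>c>0. \<exists>m::nat. m \<ge> 1 \<and>
          (\<exists>N. open N \<and> K \<subseteq> N \<and> (\<forall>x\<in>N. \<bar>f x\<bar> \<ge> c * dist_to x (zero_set \<aa>) ^ m))))"

end

theory Submission
  imports Defs
begin

text \<open>
  Write \<open>Z\<close> for the zero set of the ideal \<open>\<aa>\<close> and \<open>I\<close> for the ideal of the smooth functions that vanish
  on \<open>Z\<close>.  The saturation, the Whitney closure and the topological closure of the Lojasiewicz
  radical of \<open>\<aa>\<close> are all equal to \<open>I\<close>, for one and the same reason: near any given compact set \<open>K\<close>,
  every \<open>g\<close> in \<open>I\<close> coincides with a member of the radical.

  To see this, choose a smooth \<open>\<kappa>\<close> of compact support which is 1 near \<open>K\<close>.  The function \<open>\<kappa> g\<close> is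
  locally Lipschitz and vanishes on \<open>Z\<close>, so it is bounded by \<open>C d(x, Z)\<close> on the support of \<open>\<kappa>\<close>
  (\<open>vanishing_le_dist_on_compact\<close>).  On this compact set the Lojasiewicz inequality bounds \<open>d(x, Z)\<^sup>m\<close>
  by a multiple of \<open>\<bar>f x\<bar>\<close> for some \<open>f\<close> in \<open>\<aa>\<close>.  Hence \<open>(\<kappa> g)\<^sup>2\<^sup>m \<le> k f\<^sup>2\<close> there for a constant \<open>k\<close>, and
  the inequality is trivial off the support.  As \<open>k f\<^sup>2\<close> lies in \<open>\<aa>\<close>, the function \<open>\<kappa> g\<close> is in the
  radical (\<open>vanishing_compact_support_in_loj_radical\<close>).

  Each of the three hulls then contains \<open>I\<close>, because a germ, a Taylor series, or membership in a given
  open set of the smooth topology depends on \<open>g\<close> only near some compact set.  Conversely, the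
  radical is contained in \<open>I\<close>, since \<open>g\<^sup>2\<^sup>m \<le> f\<close> forces \<open>g\<close> to vanish where \<open>f\<close> does, and vanishing at a
  point of \<open>Z\<close> survives each of the three hulls: a germ and a Taylor series determine the value at
  their base point, and evaluation at a point is continuous in the smooth topology.

  The analytic input is elementary.  Smoothness is given by iterated directional derivatives, and
  \<open>smooth_on_coinduct\<close> turns this into a coinduction principle: it suffices to exhibit a family of
  continuous functions closed under directional derivatives.  Sums, products, inverses and
  compositions with \<open>t \<mapsto> exp (-1/t)\<close> are all treated at once by \<open>smooth_on_algebra\<close>, and these
  operations are enough to build the cutoff functions.
\<close>

section \<open>Smooth functions on relatively open subsets of a Euclidean space\<close>

lemma eventually_line_in_openin:
  fixes V :: "'b::real_normed_vector set"
  assumes "subspace V" "openin (top_of_set V) \<Omega>" "p \<in> \<Omega>" "v \<in> V"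
  shows "\<forall>\<^sub>F t in nhds 0. p + t *\<^sub>R v \<in> \<Omega>"
proof -
  obtain T where T: "open T" "\<Omega> = V \<inter> T"
    using assms(2) by (auto simp: openin_open)
  have cont: "continuous_on UNIV (\<lambda>t::real. p + t *\<^sub>R v)"
    by (intro continuous_intros)
  have "open ((\<lambda>t::real. p + t *\<^sub>R v) -` T)"
    by (rule open_vimage[OF T(1) cont])
  moreover have "0 \<in> (\<lambda>t::real. p + t *\<^sub>R v) -` T"
    using T(2) assms(3) by simp
  moreover have "p + t *\<^sub>R v \<in> V" for t :: real
    using assms(1,3,4) T(2) by (auto intro: subspace_add subspace_scale)
  ultimately show ?thesis
    unfolding eventually_nhds T(2) by blast
qed

lemma has_vector_derivative_line_cong:
  fixes V :: "'b::real_normed_vector set" and F G :: "'b \<Rightarrow> 'c::real_normed_vector"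
  assumes "subspace V" "openin (top_of_set V) \<Omega>" "p \<in> \<Omega>" "v \<in> V"
    and "\<forall>q\<in>\<Omega>. F q = G q"
  shows "((\<lambda>t. F (p + t *\<^sub>R v)) has_vector_derivative D) (at 0) \<longleftrightarrow>
         ((\<lambda>t. G (p + t *\<^sub>R v)) has_vector_derivative D) (at 0)"
proof (rule has_vector_derivative_cong_ev)
  show "\<forall>\<^sub>F t in nhds 0. t \<in> UNIV \<longrightarrow> F (p + t *\<^sub>R v) = G (p + t *\<^sub>R v)"
    using eventually_line_in_openin[OF assms(1-4)] by eventually_elim (auto simp: assms(5))
qed (use assms in auto)

lemma dir_deriv_cong:
  assumes "subspace V" "openin (top_of_set V) \<Omega>" "p \<in> \<Omega>" "v \<in> V"
    and "\<forall>q\<in>\<Omega>. F q = G q"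
  shows "dir_deriv v F p = dir_deriv v G p"
  unfolding dir_deriv_def vector_derivative_def
  by (simp add: has_vector_derivative_line_cong[OF assms])

lemma iter_deriv_cong:
  assumes "subspace V" "openin (top_of_set V) \<Omega>" "vs \<in> lists V"
    and "\<forall>q\<in>\<Omega>. F q = G q" and "p \<in> \<Omega>"
  shows "iter_deriv vs F p = iter_deriv vs G p"
  using assms(3,5)
proof (induction vs arbitrary: p)
  case (Cons v vs)
  then show ?case
    using dir_deriv_cong[OF assms(1,2), of p v "iter_deriv vs F" "iter_deriv vs G"] assms(4) by auto
qed (auto simp: assms)

lemma iter_deriv_snoc: "iter_deriv (vs @ [v]) F = iter_deriv vs (dir_deriv v F)"
  by (induction vs) auto

lemma smooth_on_subset: "smooth_on V \<Omega> F \<Longrightarrow> \<Omega>' \<subseteq> \<Omega> \<Longrightarrow> smooth_on V \<Omega>' F"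
  unfolding smooth_on_def by (meson continuous_on_subset subset_iff)

lemma smooth_on_continuous: "smooth_on V \<Omega> F \<Longrightarrow> continuous_on \<Omega> F"
  unfolding smooth_on_def by (metis iter_deriv.simps(1) lists.Nil)

lemma smooth_on_dir_deriv:
  assumes "smooth_on V \<Omega> F" "v \<in> V"
  shows "smooth_on V \<Omega> (dir_deriv v F)"
  using assms unfolding smooth_on_def
  by (metis iter_deriv_snoc append_in_lists_conv lists.Cons lists.Nil)

lemma smooth_on_has_dir_deriv:
  assumes "smooth_on V \<Omega> F" "v \<in> V" "p \<in> \<Omega>"
  shows "((\<lambda>t. F (p + t *\<^sub>R v)) has_vector_derivative dir_deriv v F p) (at 0)"
proof -
  have "(\<lambda>t. iter_deriv [] F (p + t *\<^sub>R v)) differentiable (at 0)"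
    using assms unfolding smooth_on_def by blast
  then show ?thesis
    by (simp add: dir_deriv_def vector_derivative_works)
qed

text \<open>
  Every iterated derivative of a member of \<open>\<F>\<close> coincides on \<open>\<Omega>\<close> with some member of \<open>\<F>\<close>, so it inherits
  continuity and differentiability from there.
\<close>

lemma smooth_on_coinduct:
  assumes V: "subspace V" "openin (top_of_set V) \<Omega>" and "F \<in> \<F>"
    and cont: "\<And>F. F \<in> \<F> \<Longrightarrow> continuous_on \<Omega> F"
    and step: "\<And>F v. F \<in> \<F> \<Longrightarrow> v \<in> V \<Longrightarrow>
      \<exists>G\<in>\<F>. \<forall>p\<in>\<Omega>. ((\<lambda>t. F (p + t *\<^sub>R v)) has_vector_derivative G p) (at 0)"
  shows "smooth_on V \<Omega> F"
proof -
  have ex: "\<exists>G\<in>\<F>. \<forall>p\<in>\<Omega>. iter_deriv vs F p = G p" if "vs \<in> lists V" for vs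
    using that
  proof (induction vs)
    case Nil
    then show ?case using assms(3) by auto
  next
    case (Cons v vs)
    then obtain G where G: "G \<in> \<F>" "\<forall>p\<in>\<Omega>. iter_deriv vs F p = G p" and v: "v \<in> V"
      by auto
    obtain G' where G': "G' \<in> \<F>"
      "\<And>p. p \<in> \<Omega> \<Longrightarrow> ((\<lambda>t. G (p + t *\<^sub>R v)) has_vector_derivative G' p) (at 0)"
      using step[OF G(1) v] by blast
    have "iter_deriv (v # vs) F p = G' p" if "p \<in> \<Omega>" for p
      using dir_deriv_cong[OF V that v G(2)] vector_derivative_at[OF G'(2)[OF that]]
      by (simp add: dir_deriv_def)
    then show ?case using G'(1) by blast
  qed
  show ?thesis
    unfolding smooth_on_def
  proof (intro ballI conjI)
    fix vs assume vs: "vs \<in> lists V"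
    obtain G where G: "G \<in> \<F>" "\<forall>p\<in>\<Omega>. iter_deriv vs F p = G p"
      using ex[OF vs] by blast
    show "continuous_on \<Omega> (iter_deriv vs F)"
      using cont[OF G(1)] G(2) by (simp cong: continuous_on_cong)
    fix v p assume v: "v \<in> V" and p: "p \<in> \<Omega>"
    obtain D where "((\<lambda>t. G (p + t *\<^sub>R v)) has_vector_derivative D) (at 0)"
      using step[OF G(1) v] p by blast
    then have "((\<lambda>t. iter_deriv vs F (p + t *\<^sub>R v)) has_vector_derivative D) (at 0)"
      using has_vector_derivative_line_cong[OF V p v G(2)] by simp
    then show "(\<lambda>t. iter_deriv vs F (p + t *\<^sub>R v)) differentiable (at 0)"
      by (rule differentiableI_vector)
  qed
qed

lemma smooth_on_cong:
  assumes V: "subspace V" "openin (top_of_set V) \<Omega>"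
    and sm: "smooth_on V \<Omega> F" and eq: "\<forall>p\<in>\<Omega>. F p = G p"
  shows "smooth_on V \<Omega> G"
proof (rule smooth_on_coinduct[OF V, where \<F> = "{G. \<exists>F. smooth_on V \<Omega> F \<and> (\<forall>p\<in>\<Omega>. F p = G p)}"])
  fix G v assume "G \<in> {G. \<exists>F. smooth_on V \<Omega> F \<and> (\<forall>p\<in>\<Omega>. F p = G p)}" and v: "v \<in> V"
  then obtain F where F: "smooth_on V \<Omega> F" "\<forall>p\<in>\<Omega>. F p = G p" by blast
  have "((\<lambda>t. G (p + t *\<^sub>R v)) has_vector_derivative dir_deriv v F p) (at 0)" if "p \<in> \<Omega>" for p
    using smooth_on_has_dir_deriv[OF F(1) v that] has_vector_derivative_line_cong[OF V that v F(2)]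
    by simp
  then show "\<exists>G'\<in>{G. \<exists>F. smooth_on V \<Omega> F \<and> (\<forall>p\<in>\<Omega>. F p = G p)}.
      \<forall>p\<in>\<Omega>. ((\<lambda>t. G (p + t *\<^sub>R v)) has_vector_derivative G' p) (at 0)"
    using smooth_on_dir_deriv[OF F(1) v] by blast
qed (use sm eq in \<open>auto dest: smooth_on_continuous cong: continuous_on_cong\<close>)

lemma smooth_on_const:
  assumes "subspace V" "openin (top_of_set V) \<Omega>"
  shows "smooth_on V \<Omega> (\<lambda>p. c)"
  by (rule smooth_on_coinduct[OF assms, where \<F> = "range (\<lambda>c p. c)"])
     (auto intro!: exI[of _ 0] derivative_eq_intros)

lemma smooth_on_inner:
  assumes "subspace V" "openin (top_of_set V) \<Omega>"
    and "smooth_on V \<Omega> (F :: _ \<Rightarrow> 'c::real_inner)"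
  shows "smooth_on V \<Omega> (\<lambda>p. F p \<bullet> b)"
proof (rule smooth_on_coinduct[OF assms(1,2), where \<F> = "{(\<lambda>p. F p \<bullet> b) | F. smooth_on V \<Omega> F}"])
  fix G v assume "G \<in> {(\<lambda>p. F p \<bullet> b) | F. smooth_on V \<Omega> F}" and v: "v \<in> V"
  then obtain F where G: "G = (\<lambda>p. F p \<bullet> b)" and F: "smooth_on V \<Omega> F" by blast
  have "((\<lambda>t. G (p + t *\<^sub>R v)) has_vector_derivative dir_deriv v F p \<bullet> b) (at 0)"
    if "p \<in> \<Omega>" for p
    unfolding G using bounded_linear.has_vector_derivative[OF bounded_linear_inner_left
        smooth_on_has_dir_deriv[OF F v that]] .
  then show "\<exists>G'\<in>{(\<lambda>p. F p \<bullet> b) | F. smooth_on V \<Omega> F}.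
      \<forall>p\<in>\<Omega>. ((\<lambda>t. G (p + t *\<^sub>R v)) has_vector_derivative G' p) (at 0)"
    by (intro bexI[of _ "\<lambda>p. dir_deriv v F p \<bullet> b"] ballI) (use smooth_on_dir_deriv[OF F v] in auto)
next
  show "(\<lambda>p. F p \<bullet> b) \<in> {(\<lambda>p. F p \<bullet> b) | F. smooth_on V \<Omega> F}"
    using assms(3) by blast
qed (auto dest!: smooth_on_continuous intro!: continuous_intros)

text \<open>
  Gluing: this is what allows a function supported in one chart to be extended by zero.
\<close>

lemma smooth_on_Un:
  assumes V: "openin (top_of_set V) \<Omega>\<^sub>1" "openin (top_of_set V) \<Omega>\<^sub>2"
    and "smooth_on V \<Omega>\<^sub>1 F" "smooth_on V \<Omega>\<^sub>2 F"
  shows "smooth_on V (\<Omega>\<^sub>1 \<union> \<Omega>\<^sub>2) F"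
proof -
  have "\<Omega>\<^sub>1 \<union> \<Omega>\<^sub>2 \<subseteq> V"
    using V by (auto dest: openin_imp_subset)
  then have "openin (top_of_set (\<Omega>\<^sub>1 \<union> \<Omega>\<^sub>2)) \<Omega>\<^sub>1" "openin (top_of_set (\<Omega>\<^sub>1 \<union> \<Omega>\<^sub>2)) \<Omega>\<^sub>2"
    using V by (auto intro: openin_subset_trans)
  then show ?thesis
    using assms(3,4) continuous_on_Un_local_open unfolding smooth_on_def by blast
qed

text \<open>
  These functions are \<open>t \<mapsto> t\<^sup>-\<^sup>k exp (-1/t)\<close> extended by zero.  The whole family is needed, because
  its span is closed under differentiation.
\<close>

definition flat :: "nat \<Rightarrow> real \<Rightarrow> real" where
  "flat k t = (if t > 0 then exp (- inverse t) * inverse t ^ k else 0)"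

text \<open>
  The only delicate point is 0, where the right-hand difference quotient is \<open>u\<^sup>k\<^sup>+\<^sup>1 exp (-u)\<close> with
  \<open>u = 1/t\<close>, which tends to 0.
\<close>

lemma flat_has_derivative:
  "(flat k has_real_derivative flat (k + 2) t - real k * flat (k + 1) t) (at t)"
proof -
  consider "t > 0" | "t = 0" | "t < 0" by linarith
  then show ?thesis
  proof cases
    case 1
    have "exp (- inverse t) * inverse t ^ (k + 2)
        - exp (- inverse t) * (real k * inverse t ^ (k - 1) * inverse t ^ 2)
      = flat (k + 2) t - real k * flat (k + 1) t"
      using 1 by (cases k) (simp_all add: flat_def power2_eq_square)
    moreover have "((\<lambda>t. exp (- inverse t) * inverse t ^ k) has_real_derivative
        exp (- inverse t) * inverse t ^ (k + 2)
         - exp (- inverse t) * (real k * inverse t ^ (k - 1) * inverse t ^ 2)) (at t)"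
      using 1 by (auto intro!: derivative_eq_intros simp: power2_eq_square)
    ultimately have "((\<lambda>t. exp (- inverse t) * inverse t ^ k) has_real_derivative
        flat (k + 2) t - real k * flat (k + 1) t) (at t)"
      by (rule DERIV_cong[rotated])
    moreover have "\<forall>\<^sub>F s in nhds t. flat k s = exp (- inverse s) * inverse s ^ k"
      using eventually_nhds_in_open[of "{0<..}" t] 1
      by (auto elim!: eventually_mono simp: flat_def)
    ultimately show ?thesis
      by (simp only: DERIV_cong_ev[OF refl _ refl])
  next
    case 2
    have "((\<lambda>h. inverse h ^ (k + 1) / exp (inverse h)) \<longlongrightarrow> (0::real)) (at_right 0)"
      by (rule filterlim_compose[OF tendsto_power_div_exp_0 filterlim_inverse_at_top_right])
    then have "((\<lambda>h. flat k h / h) \<longlongrightarrow> 0) (at_right 0)"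
      by (rule Lim_transform_eventually)
         (auto simp: eventually_at_filter flat_def exp_minus field_simps power_inverse)
    moreover have "((\<lambda>h. flat k h / h) \<longlongrightarrow> 0) (at_left 0)"
      by (rule Lim_transform_eventually[OF tendsto_const])
         (auto simp: eventually_at_filter flat_def)
    ultimately have "((\<lambda>h. flat k h / h) \<longlongrightarrow> 0) (at 0)"
      by (simp add: filterlim_split_at)
    then show ?thesis
      unfolding has_field_derivative_iff 2 by (simp add: flat_def)
  next
    case 3
    have "\<forall>\<^sub>F s in nhds t. flat k s = 0"
      using eventually_nhds_in_open[of "{..<0}" t] 3
      by (auto elim!: eventually_mono simp: flat_def)
    then have "(flat k has_real_derivative 0) (at t)"
      using DERIV_cong_ev[OF refl _ refl, of "flat k" "\<lambda>_. 0" t] by simp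
    then show ?thesis
      using 3 by (simp add: flat_def)
  qed
qed

lemma continuous_on_flat: "continuous_on UNIV (flat k)"
  by (intro continuous_at_imp_continuous_on ballI DERIV_isCont[OF flat_has_derivative])

text \<open>
  The family for the coinduction.  It is closed under all the operations at once because the derivative of
  one operation calls for the others: that of \<open>flat k \<circ> F\<close>, for instance, is a product of a sum with
  the derivative of \<open>F\<close>.
\<close>

inductive_set smooth_algebra :: "'b::euclidean_space set \<Rightarrow> 'b set \<Rightarrow> ('b \<Rightarrow> real) set"
  for V \<Omega> where
  base: "smooth_on V \<Omega> F \<Longrightarrow> F \<in> smooth_algebra V \<Omega>"
| add: "F \<in> smooth_algebra V \<Omega> \<Longrightarrow> G \<in> smooth_algebra V \<Omega> \<Longrightarrow>
    (\<lambda>p. F p + G p) \<in> smooth_algebra V \<Omega>"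
| mult: "F \<in> smooth_algebra V \<Omega> \<Longrightarrow> G \<in> smooth_algebra V \<Omega> \<Longrightarrow>
    (\<lambda>p. F p * G p) \<in> smooth_algebra V \<Omega>"
| inverse: "F \<in> smooth_algebra V \<Omega> \<Longrightarrow> \<forall>p\<in>\<Omega>. F p \<noteq> 0 \<Longrightarrow>
    (\<lambda>p. inverse (F p)) \<in> smooth_algebra V \<Omega>"
| flat: "F \<in> smooth_algebra V \<Omega> \<Longrightarrow> (\<lambda>p. flat k (F p)) \<in> smooth_algebra V \<Omega>"

lemma smooth_on_algebra:
  assumes V: "subspace V" "openin (top_of_set V) \<Omega>" and F: "F \<in> smooth_algebra V \<Omega>"
  shows "smooth_on V \<Omega> F"
proof (rule smooth_on_coinduct[OF V F])
  show "continuous_on \<Omega> F" if "F \<in> smooth_algebra V \<Omega>" for F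
    using that
  proof induction
    case (flat F k)
    then show ?case
      by (intro continuous_on_compose2[OF continuous_on_flat]) auto
  qed (auto intro!: continuous_intros dest: smooth_on_continuous)
next
  fix F :: "'a \<Rightarrow> real" and v
  assume F: "F \<in> smooth_algebra V \<Omega>" and v: "v \<in> V"
  have const: "(\<lambda>p. c) \<in> smooth_algebra V \<Omega>" for c
    by (intro smooth_algebra.base smooth_on_const V)
  show "\<exists>G\<in>smooth_algebra V \<Omega>.
      \<forall>p\<in>\<Omega>. ((\<lambda>t. F (p + t *\<^sub>R v)) has_vector_derivative G p) (at 0)"
    using F unfolding has_real_derivative_iff_has_vector_derivative[symmetric]
  proof induction
    case (base F)
    then show ?case
      using smooth_on_dir_deriv[OF _ v] smooth_on_has_dir_deriv[OF _ v] smooth_algebra.base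
      unfolding has_real_derivative_iff_has_vector_derivative by blast
  next
    case (add F G)
    then obtain F' G' where *: "F' \<in> smooth_algebra V \<Omega>" "G' \<in> smooth_algebra V \<Omega>"
      "\<And>p. p \<in> \<Omega> \<Longrightarrow> ((\<lambda>t. F (p + t *\<^sub>R v)) has_real_derivative F' p) (at 0)"
      "\<And>p. p \<in> \<Omega> \<Longrightarrow> ((\<lambda>t. G (p + t *\<^sub>R v)) has_real_derivative G' p) (at 0)"
      by blast
    show ?case
      using DERIV_add[OF *(3,4)] by (intro bexI[OF _ smooth_algebra.add[OF *(1,2)]] ballI)
  next
    case (mult F G)
    then obtain F' G' where *: "F' \<in> smooth_algebra V \<Omega>" "G' \<in> smooth_algebra V \<Omega>"
      "\<And>p. p \<in> \<Omega> \<Longrightarrow> ((\<lambda>t. F (p + t *\<^sub>R v)) has_real_derivative F' p) (at 0)"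
      "\<And>p. p \<in> \<Omega> \<Longrightarrow> ((\<lambda>t. G (p + t *\<^sub>R v)) has_real_derivative G' p) (at 0)"
      by blast
    show ?case
      using DERIV_mult'[OF *(3,4)]
      by (intro bexI[OF _ smooth_algebra.add[OF smooth_algebra.mult[OF mult.hyps(1) *(2)]
              smooth_algebra.mult[OF *(1) mult.hyps(2)]]] ballI) simp
  next
    case (inverse F)
    then obtain F' where *: "F' \<in> smooth_algebra V \<Omega>"
      "\<And>p. p \<in> \<Omega> \<Longrightarrow> ((\<lambda>t. F (p + t *\<^sub>R v)) has_real_derivative F' p) (at 0)"
      by blast
    have inv: "(\<lambda>p. inverse (F p)) \<in> smooth_algebra V \<Omega>"
      using inverse.hyps by (rule smooth_algebra.inverse)
    let ?D = "\<lambda>p. (- 1) * F' p * (inverse (F p) * inverse (F p))"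
    have "?D \<in> smooth_algebra V \<Omega>"
      by (rule smooth_algebra.mult[OF smooth_algebra.mult[OF const *(1)] smooth_algebra.mult[OF inv inv]])
    moreover have "((\<lambda>t. inverse (F (p + t *\<^sub>R v))) has_real_derivative ?D p) (at 0)"
      if "p \<in> \<Omega>" for p
      using DERIV_inverse'[OF *(2)[OF that]] inverse.hyps(2) that by (simp add: ac_simps)
    ultimately show ?case by (intro bexI[of _ ?D] ballI)
  next
    case (flat F k)
    then obtain F' where *: "F' \<in> smooth_algebra V \<Omega>"
      "\<And>p. p \<in> \<Omega> \<Longrightarrow> ((\<lambda>t. F (p + t *\<^sub>R v)) has_real_derivative F' p) (at 0)"
      by blast
    let ?D = "\<lambda>p. (flat (k + 2) (F p) + (- real k) * flat (k + 1) (F p)) * F' p"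
    have "?D \<in> smooth_algebra V \<Omega>"
      by (rule smooth_algebra.mult[OF smooth_algebra.add[OF smooth_algebra.flat[OF flat.hyps(1)]
              smooth_algebra.mult[OF const smooth_algebra.flat[OF flat.hyps(1)]]] *(1)])
    moreover have "((\<lambda>t. flat k (F (p + t *\<^sub>R v))) has_real_derivative ?D p) (at 0)"
      if "p \<in> \<Omega>" for p
      using DERIV_chain2[where f = "flat k", OF flat_has_derivative *(2)[OF that]] by simp
    ultimately show ?case by (intro bexI[of _ ?D] ballI)
  qed
qed

lemma
  fixes F G :: "'b::euclidean_space \<Rightarrow> real"
  assumes V: "subspace V" "openin (top_of_set V) \<Omega>" and F: "smooth_on V \<Omega> F"
  shows smooth_on_add: "smooth_on V \<Omega> G \<Longrightarrow> smooth_on V \<Omega> (\<lambda>p. F p + G p)"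
    and smooth_on_mult: "smooth_on V \<Omega> G \<Longrightarrow> smooth_on V \<Omega> (\<lambda>p. F p * G p)"
    and smooth_on_inverse: "\<forall>p\<in>\<Omega>. F p \<noteq> 0 \<Longrightarrow> smooth_on V \<Omega> (\<lambda>p. inverse (F p))"
    and smooth_on_flat: "smooth_on V \<Omega> (\<lambda>p. flat k (F p))"
proof -
  note mem = smooth_algebra.base[OF F]
  show "smooth_on V \<Omega> (\<lambda>p. F p + G p)" if "smooth_on V \<Omega> G"
    by (rule smooth_on_algebra[OF V smooth_algebra.add[OF mem smooth_algebra.base[OF that]]])
  show "smooth_on V \<Omega> (\<lambda>p. F p * G p)" if "smooth_on V \<Omega> G"
    by (rule smooth_on_algebra[OF V smooth_algebra.mult[OF mem smooth_algebra.base[OF that]]])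
  show "smooth_on V \<Omega> (\<lambda>p. inverse (F p))" if "\<forall>p\<in>\<Omega>. F p \<noteq> 0"
    by (rule smooth_on_algebra[OF V smooth_algebra.inverse[OF mem that]])
  show "smooth_on V \<Omega> (\<lambda>p. flat k (F p))"
    by (rule smooth_on_algebra[OF V smooth_algebra.flat[OF mem]])
qed

section \<open>Smooth functions and cutoff functions on a manifold\<close>

locale smooth_manifold =
  fixes V :: "'b::euclidean_space set" and A :: "('a::metric_space, 'b) chart set"
  assumes atlas: "smooth_atlas V A"
begin

lemma subspace_V: "subspace V"
  using atlas by (simp add: smooth_atlas_def)

lemma chart_cover: obtains U \<phi> where "(U, \<phi>) \<in> A" "x \<in> U"
proof -
  have "x \<in> (\<Union>(U, \<phi>)\<in>A. U)"
    using atlas unfolding smooth_atlas_def by simp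
  then show ?thesis using that by auto
qed

lemma
  assumes "(U, \<phi>) \<in> A"
  shows chart_open: "open U"
    and chart_homeomorphism: "homeomorphism U (\<phi> ` U) \<phi> (inv_into U \<phi>)"
    and chart_image_openin: "openin (top_of_set V) (\<phi> ` U)"
  using atlas assms unfolding smooth_atlas_def by auto

lemma chart_inv:
  assumes "(U, \<phi>) \<in> A" "x \<in> U"
  shows "inv_into U \<phi> (\<phi> x) = x"
  using chart_homeomorphism[OF assms(1)] assms(2) by (simp add: homeomorphism_def)

lemma chart_continuous: "(U, \<phi>) \<in> A \<Longrightarrow> continuous_on U \<phi>"
  using chart_homeomorphism homeomorphism_def by blast

lemma chart_image_open:
  assumes "(U, \<phi>) \<in> A" "open N"
  shows "openin (top_of_set V) (\<phi> ` (U \<inter> N))"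
  using homeomorphism_imp_open_map[OF chart_homeomorphism[OF assms(1)], of "U \<inter> N"] assms(2)
    chart_image_openin[OF assms(1)]
  by (meson openin_open_Int openin_trans)

lemma chart_image_in: "(U, \<phi>) \<in> A \<Longrightarrow> x \<in> U \<Longrightarrow> \<phi> x \<in> V"
  using chart_image_openin openin_imp_subset by blast

abbreviation smooth :: "'a set \<Rightarrow> ('a \<Rightarrow> real) \<Rightarrow> bool" where
  "smooth \<equiv> smooth_fun_on V A"

lemma smoothD: "smooth N f \<Longrightarrow> (U, \<phi>) \<in> A \<Longrightarrow> smooth_on V (\<phi> ` (U \<inter> N)) (f \<circ> inv_into U \<phi>)"
  unfolding smooth_fun_on_def by auto

lemma smoothI:
  "(\<And>U \<phi>. (U, \<phi>) \<in> A \<Longrightarrow> smooth_on V (\<phi> ` (U \<inter> N)) (f \<circ> inv_into U \<phi>)) \<Longrightarrow> smooth N f"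
  unfolding smooth_fun_on_def by auto

lemma smooth_subset: "smooth N f \<Longrightarrow> N' \<subseteq> N \<Longrightarrow> smooth N' f"
  unfolding smooth_fun_on_def by (fastforce intro: smooth_on_subset)

lemma smooth_const: "open N \<Longrightarrow> smooth N (\<lambda>x. c)"
  by (intro smoothI) (simp add: comp_def smooth_on_const subspace_V chart_image_open)

lemma smooth_add:
  assumes "open N" "smooth N f" "smooth N g"
  shows "smooth N (\<lambda>x. f x + g x)"
  using smooth_on_add[OF subspace_V chart_image_open smoothD smoothD] assms
  by (intro smoothI) (simp add: comp_def)

lemma smooth_mult:
  assumes "open N" "smooth N f" "smooth N g"
  shows "smooth N (\<lambda>x. f x * g x)"
  using smooth_on_mult[OF subspace_V chart_image_open smoothD smoothD] assms
  by (intro smoothI) (simp add: comp_def)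

lemma smooth_inverse:
  assumes N: "open N" and f: "smooth N f" "\<forall>x\<in>N. f x \<noteq> 0"
  shows "smooth N (\<lambda>x. inverse (f x))"
proof (rule smoothI)
  fix U \<phi> assume c: "(U, \<phi>) \<in> A"
  have "\<forall>p\<in>\<phi> ` (U \<inter> N). (f \<circ> inv_into U \<phi>) p \<noteq> 0"
    using f(2) chart_inv[OF c] by auto
  from smooth_on_inverse[OF subspace_V chart_image_open[OF c N] smoothD[OF f(1) c] this]
  show "smooth_on V (\<phi> ` (U \<inter> N)) ((\<lambda>x. inverse (f x)) \<circ> inv_into U \<phi>)"
    by (simp add: comp_def)
qed

lemma smooth_flat:
  assumes "open N" "smooth N f"
  shows "smooth N (\<lambda>x. flat k (f x))"
  using smooth_on_flat[OF subspace_V chart_image_open smoothD] assms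
  by (intro smoothI) (simp add: comp_def)

lemma smooth_minus: "open N \<Longrightarrow> smooth N f \<Longrightarrow> smooth N (\<lambda>x. - f x)"
  using smooth_mult[OF _ smooth_const[of N "- 1"], of f] by simp

lemma smooth_sum:
  assumes "open N" "\<And>i. i \<in> I \<Longrightarrow> smooth N (f i)"
  shows "smooth N (\<lambda>x. \<Sum>i\<in>I. f i x)"
  using assms(2)
proof (induction I rule: infinite_finite_induct)
  case (insert i I)
  have "smooth N (\<lambda>x. f i x + (\<Sum>i\<in>I. f i x))"
    by (rule smooth_add[OF assms(1)]) (use insert in auto)
  then show ?case
    using insert.hyps by simp
qed (simp_all add: smooth_const[OF assms(1)])

lemma smooth_power: "open N \<Longrightarrow> smooth N f \<Longrightarrow> smooth N (\<lambda>x. f x ^ n)"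
  by (induction n) (simp_all add: smooth_const smooth_mult)

lemma smooth_Un:
  assumes "open N\<^sub>1" "open N\<^sub>2" "smooth N\<^sub>1 f" "smooth N\<^sub>2 f"
  shows "smooth (N\<^sub>1 \<union> N\<^sub>2) f"
proof (rule smoothI)
  fix U \<phi> assume c: "(U, \<phi>) \<in> A"
  show "smooth_on V (\<phi> ` (U \<inter> (N\<^sub>1 \<union> N\<^sub>2))) (f \<circ> inv_into U \<phi>)"
    using smooth_on_Un[OF chart_image_open[OF c assms(1)] chart_image_open[OF c assms(2)]
        smoothD[OF assms(3) c] smoothD[OF assms(4) c]]
    by (simp add: Int_Un_distrib image_Un)
qed

lemma smooth_cong:
  assumes "open N" "smooth N f" "\<forall>x\<in>N. f x = g x"
  shows "smooth N g"
proof (rule smoothI)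
  fix U \<phi> assume c: "(U, \<phi>) \<in> A"
  show "smooth_on V (\<phi> ` (U \<inter> N)) (g \<circ> inv_into U \<phi>)"
    by (rule smooth_on_cong[OF subspace_V chart_image_open[OF c assms(1)] smoothD[OF assms(2) c]])
       (use assms(3) chart_inv[OF c] in auto)
qed

text \<open>
  This is where smoothness of the transition maps enters.  Cutoff functions are then built from these
  scalar coordinates by algebraic operations and by \<open>flat\<close>, which takes the place of
  a chain rule for maps between vector spaces.
\<close>

lemma smooth_coordinate:
  assumes "(W, \<psi>) \<in> A"
  shows "smooth W (\<lambda>x. \<psi> x \<bullet> b)"
proof (rule smoothI)
  fix U \<phi> assume c: "(U, \<phi>) \<in> A"
  have "smooth_on V (\<phi> ` (U \<inter> W)) (\<psi> \<circ> inv_into U \<phi>)"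
    using atlas assms c unfolding smooth_atlas_def by fast
  from smooth_on_inner[OF subspace_V chart_image_open[OF c chart_open[OF assms]] this, of b]
  show "smooth_on V (\<phi> ` (U \<inter> W)) ((\<lambda>x. \<psi> x \<bullet> b) \<circ> inv_into U \<phi>)"
    by (simp add: comp_def)
qed

lemma smooth_continuous:
  assumes "open N" "smooth N f"
  shows "continuous_on N f"
proof (rule continuous_at_imp_continuous_on, rule ballI)
  fix x assume x: "x \<in> N"
  obtain U \<phi> where c: "(U, \<phi>) \<in> A" and xU: "x \<in> U" by (rule chart_cover)
  have "continuous_on (U \<inter> N) ((f \<circ> inv_into U \<phi>) \<circ> \<phi>)"
    by (rule continuous_on_compose[OF continuous_on_subset[OF chart_continuous[OF c]]
          smooth_on_continuous[OF smoothD[OF assms(2) c]]]) simp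
  then have "continuous_on (U \<inter> N) f"
    by (rule continuous_on_eq) (use chart_inv[OF c] in auto)
  then show "isCont f x"
    using x xU assms(1) chart_open[OF c] continuous_on_eq_continuous_at[of "U \<inter> N"] by auto
qed

lemma compact_chart_ball:
  assumes c: "(U, \<phi>) \<in> A" and x: "x \<in> U"
  obtains r where "r > 0" "cball (\<phi> x) r \<inter> V \<subseteq> \<phi> ` U"
    "compact (inv_into U \<phi> ` (cball (\<phi> x) r \<inter> V))"
proof -
  obtain r where r: "r > 0" "cball (\<phi> x) r \<inter> V \<subseteq> \<phi> ` U"
    using chart_image_openin[OF c] x unfolding openin_contains_cball by blast
  have "continuous_on (\<phi> ` U) (inv_into U \<phi>)"
    using chart_homeomorphism[OF c] by (simp add: homeomorphism_def)
  then have "compact (inv_into U \<phi> ` (cball (\<phi> x) r \<inter> V))"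
    using r(2) closed_subspace[OF subspace_V]
    by (intro compact_continuous_image compact_Int_closed) (auto intro: continuous_on_subset)
  with r show ?thesis using that by blast
qed

text \<open>
  In a chart around \<open>x\<^sub>0\<close>, compose a smooth step function (0 on \<open>t \<le> 0\<close> and 1 on \<open>t \<ge> 1\<close>) with
  \<open>\<tau> = 2 - 2 \<bar>\<phi> x - \<phi> x\<^sub>0\<bar>\<^sup>2 / r\<^sup>2\<close>, and extend by zero.  The extension is smooth because the preimage \<open>L\<close>
  of the closed ball is compact, hence closed in the manifold, and the function vanishes on its
  complement.
\<close>

lemma bump_at_point:
  obtains \<kappa> L W where "smooth UNIV \<kappa>" "compact L" "\<forall>x. x \<notin> L \<longrightarrow> \<kappa> x = 0"
    "open W" "x\<^sub>0 \<in> W" "\<forall>x\<in>W. \<kappa> x = 1"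
proof -
  obtain U \<phi> where c: "(U, \<phi>) \<in> A" and x0: "x\<^sub>0 \<in> U" by (rule chart_cover)
  obtain r where r: "r > 0" "cball (\<phi> x\<^sub>0) r \<inter> V \<subseteq> \<phi> ` U"
    "compact (inv_into U \<phi> ` (cball (\<phi> x\<^sub>0) r \<inter> V))"
    using compact_chart_ball[OF c x0] .
  define L where "L = inv_into U \<phi> ` (cball (\<phi> x\<^sub>0) r \<inter> V)"
  \<comment> \<open>Sums and negations are spelled with \<open>+\<close> and constant factors to match the closure rules.\<close>
  define \<tau> where "\<tau> x = 2 + (- 2 / r\<^sup>2) * (\<Sum>b\<in>Basis. (\<phi> x \<bullet> b + - (\<phi> x\<^sub>0 \<bullet> b))\<^sup>2)" for x
  define step where "step t = flat 0 t * inverse (flat 0 t + flat 0 (1 + (- 1) * t))" for t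
  define \<kappa> where "\<kappa> x = (if x \<in> U then step (\<tau> x) else 0)" for x
  have \<tau>: "\<tau> x = 2 - 2 * (dist (\<phi> x) (\<phi> x\<^sub>0))\<^sup>2 / r\<^sup>2" for x
    unfolding \<tau>_def dist_norm power2_norm_eq_inner
    by (subst euclidean_inner) (simp add: inner_diff_left power2_eq_square)
  have flat_pos: "flat 0 t + flat 0 (1 + (- 1) * t) > 0" for t
    by (auto simp: flat_def add_pos_pos)
  have sm\<tau>: "smooth U \<tau>"
    unfolding \<tau>_def using chart_open[OF c]
    by (intro smooth_add smooth_mult smooth_const smooth_sum smooth_power smooth_coordinate[OF c])
  have "smooth U (\<lambda>x. step (\<tau> x))"
    unfolding step_def using chart_open[OF c] sm\<tau> flat_pos
    by (intro smooth_mult smooth_inverse smooth_add smooth_flat smooth_const ballI)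
       (auto simp: less_imp_neq[symmetric])
  then have smU: "smooth U \<kappa>"
    by (rule smooth_cong[OF chart_open[OF c]]) (simp add: \<kappa>_def)
  have off: "\<kappa> x = 0" if "x \<notin> L" for x
  proof (cases "x \<in> U")
    case True
    have "\<phi> x \<notin> cball (\<phi> x\<^sub>0) r"
      using that chart_inv[OF c True] chart_image_in[OF c True] unfolding L_def
      by (metis IntI imageI)
    then have "r\<^sup>2 \<le> (dist (\<phi> x) (\<phi> x\<^sub>0))\<^sup>2"
      using r(1) by (intro power_mono) (auto simp: dist_commute)
    then have "\<tau> x \<le> 0"
      using r(1) by (simp add: \<tau> field_simps)
    then show ?thesis by (simp add: \<kappa>_def step_def flat_def)
  qed (simp add: \<kappa>_def)
  have "L \<subseteq> U"
    using r(2) chart_inv[OF c] unfolding L_def by force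
  moreover have L: "compact L" using r(3) by (simp add: L_def)
  then have "open (- L)" by (simp add: compact_imp_closed open_Compl)
  moreover have "smooth (- L) \<kappa>"
    by (rule smooth_cong[OF \<open>open (- L)\<close> smooth_const[OF \<open>open (- L)\<close>, of 0]]) (simp add: off)
  ultimately have sm: "smooth UNIV \<kappa>"
    using smooth_Un[OF chart_open[OF c] _ smU, of "- L"]
    by (metis Compl_partition2 Un_UNIV_right sup.absorb_iff2 sup_assoc sup_commute)
  define W where "W = U \<inter> \<phi> -` ball (\<phi> x\<^sub>0) (r / 2)"
  have "open W"
    unfolding W_def by (rule continuous_open_preimage[OF chart_continuous[OF c] chart_open[OF c]]) simp
  moreover have "x\<^sub>0 \<in> W" using x0 r(1) by (simp add: W_def)
  moreover have "\<kappa> x = 1" if "x \<in> W" for x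
  proof -
    have "(dist (\<phi> x) (\<phi> x\<^sub>0))\<^sup>2 \<le> (r / 2)\<^sup>2"
      using that by (intro power_mono) (auto simp: W_def dist_commute)
    also have "(r / 2)\<^sup>2 = r\<^sup>2 / 4" by (simp add: power_divide)
    finally have "(dist (\<phi> x) (\<phi> x\<^sub>0))\<^sup>2 \<le> r\<^sup>2 / 4" .
    then have "2 * (dist (\<phi> x) (\<phi> x\<^sub>0))\<^sup>2 \<le> r\<^sup>2"
      using zero_le_power2[of "dist (\<phi> x) (\<phi> x\<^sub>0)"] by linarith
    then have "\<tau> x \<ge> 1"
      using r(1) by (simp add: \<tau> field_simps)
    then show ?thesis
      using that by (simp add: \<kappa>_def step_def W_def flat_def)
  qed
  ultimately show ?thesis
    using that[OF sm L] off by blast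
qed

lemma cutoff:
  assumes "compact K"
  obtains \<kappa> L W where "smooth UNIV \<kappa>" "compact L" "\<forall>x. x \<notin> L \<longrightarrow> \<kappa> x = 0"
    "open W" "K \<subseteq> W" "\<forall>x\<in>W. \<kappa> x = 1"
proof -
  have "\<exists>W. open W \<and> x \<in> W \<and> (\<exists>\<kappa> L. smooth UNIV \<kappa> \<and> compact L \<and> (\<forall>y. y \<notin> L \<longrightarrow> \<kappa> y = 0) \<and>
      (\<forall>y\<in>W. \<kappa> y = 1))" for x
    using bump_at_point[of x] by metis
  then obtain W where W: "\<And>x. open (W x)" "\<And>x. x \<in> W x"
    and bump: "\<And>x. \<exists>\<kappa> L. smooth UNIV \<kappa> \<and> compact L \<and> (\<forall>y. y \<notin> L \<longrightarrow> \<kappa> y = 0) \<and> (\<forall>y\<in>W x. \<kappa> y = 1)"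
    by metis
  obtain D where D: "D \<subseteq> K" "finite D" "K \<subseteq> (\<Union>x\<in>D. W x)"
    using compactE_image[OF assms, of K W] W by blast
  have "\<exists>\<kappa> L. smooth UNIV \<kappa> \<and> compact L \<and> (\<forall>y. y \<notin> L \<longrightarrow> \<kappa> y = 0) \<and> (\<forall>y\<in>\<Union>x\<in>D. W x. \<kappa> y = 1)"
    using D(2)
  proof (induction D rule: finite_induct)
    case empty
    show ?case
      by (rule exI[of _ "\<lambda>x. 0"], rule exI[of _ "{}"]) (simp add: smooth_const)
  next
    case (insert x D)
    obtain \<kappa> L where 1: "smooth UNIV \<kappa>" "compact L" "\<And>y. y \<notin> L \<Longrightarrow> \<kappa> y = 0"
      "\<And>y. y \<in> (\<Union>x\<in>D. W x) \<Longrightarrow> \<kappa> y = 1"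
      using insert.IH by metis
    obtain \<kappa>' L' where 2: "smooth UNIV \<kappa>'" "compact L'" "\<And>y. y \<notin> L' \<Longrightarrow> \<kappa>' y = 0"
      "\<And>y. y \<in> W x \<Longrightarrow> \<kappa>' y = 1"
      using bump[of x] by metis
    \<comment> \<open>This is \<open>1 - (1 - \<kappa>) (1 - \<kappa>')\<close>, which is 1 as soon as \<open>\<kappa>\<close> or \<open>\<kappa>'\<close> is.\<close>
    let ?\<xi> = "\<lambda>y. \<kappa> y + \<kappa>' y + - (\<kappa> y * \<kappa>' y)"
    have "smooth UNIV ?\<xi>"
      using 1(1) 2(1) by (intro smooth_add smooth_minus smooth_mult) auto
    moreover have "compact (L \<union> L')" using 1(2) 2(2) by (rule compact_Un)
    moreover have "?\<xi> y = 0" if "y \<notin> L \<union> L'" for y using that 1(3) 2(3) by simp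
    moreover have "?\<xi> y = 1" if "y \<in> (\<Union>x\<in>insert x D. W x)" for y
    proof (cases "y \<in> W x")
      case False
      then have "y \<in> (\<Union>x\<in>D. W x)" using that by auto
      then show ?thesis using 1(4) by simp
    qed (simp add: 2(4))
    ultimately show ?case by meson
  qed
  then obtain \<kappa> L where "smooth UNIV \<kappa>" "compact L" "\<forall>y. y \<notin> L \<longrightarrow> \<kappa> y = 0" "\<forall>y\<in>\<Union>x\<in>D. W x. \<kappa> y = 1"
    by metis
  moreover have "open (\<Union>x\<in>D. W x)" using W(1) by blast
  ultimately show ?thesis using that D(3) by metis
qed

end

section \<open>Smooth functions are dominated by the distance to their zeros\<close>

lemma smooth_on_bound_along_line:
  assumes sm: "smooth_on V \<Omega> (F :: 'b::euclidean_space \<Rightarrow> real)" and b: "b \<in> V"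
    and line: "\<And>s. \<bar>s\<bar> \<le> d \<Longrightarrow> z + s *\<^sub>R b \<in> \<Omega>"
    and bound: "\<And>s. \<bar>s\<bar> \<le> d \<Longrightarrow> \<bar>dir_deriv b F (z + s *\<^sub>R b)\<bar> \<le> M"
    and "\<bar>s\<bar> \<le> d"
  shows "\<bar>F (z + s *\<^sub>R b) - F z\<bar> \<le> M * \<bar>s\<bar>"
proof -
  define g where "g s = F (z + s *\<^sub>R b)" for s
  have "(g has_real_derivative dir_deriv b F (z + s *\<^sub>R b)) (at s)" if "\<bar>s\<bar> \<le> d" for s
  proof -
    have "((\<lambda>t. F (z + s *\<^sub>R b + t *\<^sub>R b)) has_real_derivative dir_deriv b F (z + s *\<^sub>R b)) (at 0)"
      using smooth_on_has_dir_deriv[OF sm b line[OF that]]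
      by (simp add: has_real_derivative_iff_has_vector_derivative)
    then have "((\<lambda>t. g (t + s)) has_real_derivative dir_deriv b F (z + s *\<^sub>R b)) (at 0)"
      by (simp add: g_def algebra_simps)
    then show ?thesis
      using DERIV_shift[of g _ 0 s] by simp
  qed
  then have "norm (g s - g 0) \<le> M * norm (s - 0)"
    using assms(5) bound
    by (intro field_differentiable_bound[of "cball 0 d" g "\<lambda>s. dir_deriv b F (z + s *\<^sub>R b)"])
       (auto intro: has_field_derivative_at_within)
  then show ?thesis by (simp add: g_def)
qed

text \<open>
  Walk from \<open>x\<close> to \<open>y\<close> parallel to the axes of an orthonormal basis of \<open>V\<close>, one axis at a time, and
  apply the mean value theorem on each leg.  The finitely many partial derivatives along the axes are
  continuous, hence bounded on a closed ball that contains the whole path.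
\<close>

lemma smooth_on_locally_lipschitz:
  fixes F :: "'b::euclidean_space \<Rightarrow> real"
  assumes V: "subspace V" "openin (top_of_set V) \<Omega>" and sm: "smooth_on V \<Omega> F" and p: "p \<in> \<Omega>"
  obtains e M where "e > 0" "M \<ge> 0"
    "\<And>x y. x \<in> ball p e \<inter> V \<Longrightarrow> y \<in> ball p e \<inter> V \<Longrightarrow> \<bar>F y - F x\<bar> \<le> M * dist x y"
proof -
  obtain B where B: "B \<subseteq> V" "pairwise orthogonal B" "\<And>b. b \<in> B \<Longrightarrow> norm b = 1"
    "independent B" "span B = V"
    using orthonormal_basis_subspace[OF V(1)] by metis
  have finB: "finite B" using B(4) by (rule independent_imp_finite)
  obtain r where r: "r > 0" "cball p r \<inter> V \<subseteq> \<Omega>"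
    using V(2) p unfolding openin_contains_cball by blast
  have "compact (\<Union>b\<in>B. dir_deriv b F ` (cball p r \<inter> V))"
  proof (intro compact_UN finB compact_continuous_image)
    fix b assume "b \<in> B"
    then show "continuous_on (cball p r \<inter> V) (dir_deriv b F)"
      using B(1) r(2) smooth_on_continuous[OF smooth_on_dir_deriv[OF sm]]
      by (meson continuous_on_subset subsetD)
  qed (simp add: compact_Int_closed closed_subspace[OF V(1)])
  then have "bounded (\<Union>b\<in>B. dir_deriv b F ` (cball p r \<inter> V))"
    by (rule compact_imp_bounded)
  then obtain M where M: "M > 0"
    "\<And>b q. b \<in> B \<Longrightarrow> q \<in> cball p r \<inter> V \<Longrightarrow> \<bar>dir_deriv b F q\<bar> \<le> M"
    unfolding bounded_pos by (auto simp: real_norm_def)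
  \<comment> \<open>All corners of the broken path stay within \<open>e + card B * 2 e = r\<close> of \<open>p\<close>.\<close>
  define e where "e = r / (2 * real (card B) + 1)"
  have e: "e > 0" "e + real (card B) * (2 * e) = r"
  proof -
    show "e > 0" using r(1) by (simp add: e_def)
    have "e * (2 * real (card B) + 1) = r" by (simp add: e_def)
    then show "e + real (card B) * (2 * e) = r" by (simp add: algebra_simps)
  qed
  have "\<bar>F y - F x\<bar> \<le> (real (card B) * M) * dist x y"
    if x: "x \<in> ball p e \<inter> V" and y: "y \<in> ball p e \<inter> V" for x y
  proof -
    define d where "d = dist x y"
    define c where "c b = (y - x) \<bullet> b" for b
    have d: "d \<le> 2 * e" "d \<ge> 0"
      using x y dist_triangle2[of x y p] by (auto simp: d_def dist_commute)
    have c: "\<bar>c b\<bar> \<le> d" if "b \<in> B" for b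
      using Cauchy_Schwarz_ineq2[of "y - x" b] B(3)[OF that]
      by (simp add: c_def d_def dist_norm norm_minus_commute)
    have part: "\<bar>F (x + (\<Sum>b\<in>S. c b *\<^sub>R b)) - F x\<bar> \<le> real (card S) * (M * d)" if "S \<subseteq> B" for S
      using finite_subset[OF that finB] that
    proof (induction S rule: finite_induct)
      case (insert b S)
      have b: "b \<in> B" and S: "S \<subseteq> B" using insert.prems by auto
      define z where "z = x + (\<Sum>b\<in>S. c b *\<^sub>R b)"
      have zV: "z \<in> V"
        unfolding z_def using x S B(1)
        by (intro subspace_add[OF V(1)] subspace_sum[OF V(1)] subspace_scale[OF V(1)]) auto
      have bV: "b \<in> V" using b B(1) by auto
      have stay: "z + s *\<^sub>R b \<in> cball p r \<inter> V" if s: "\<bar>s\<bar> \<le> d" for s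
      proof -
        have "norm (\<Sum>b\<in>S. c b *\<^sub>R b) \<le> (\<Sum>b\<in>S. d)"
          using S c B(3) by (intro sum_norm_le) (auto simp: subset_iff)
        then have "norm (\<Sum>b\<in>S. c b *\<^sub>R b) \<le> real (card S) * d" by simp
        moreover have "dist p (z + s *\<^sub>R b) \<le> norm (x - p) + (norm (\<Sum>b\<in>S. c b *\<^sub>R b) + norm (s *\<^sub>R b))"
        proof -
          have "dist p (z + s *\<^sub>R b) = norm ((x - p) + ((\<Sum>b\<in>S. c b *\<^sub>R b) + s *\<^sub>R b))"
            by (subst dist_commute) (simp add: z_def dist_norm algebra_simps)
          then show ?thesis
            using norm_triangle_ineq[of "x - p" "(\<Sum>b\<in>S. c b *\<^sub>R b) + s *\<^sub>R b"]
              norm_triangle_ineq[of "\<Sum>b\<in>S. c b *\<^sub>R b" "s *\<^sub>R b"] by linarith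
        qed
        moreover have "norm (x - p) \<le> e" using x by (simp add: dist_norm norm_minus_commute)
        moreover have "norm (s *\<^sub>R b) \<le> d" using s B(3)[OF b] by simp
        moreover have "(real (card S) + 1) * d \<le> real (card B) * (2 * e)"
        proof (rule mult_mono)
          have "card (insert b S) \<le> card B"
            using insert.prems finB by (rule card_mono[rotated])
          then show "real (card S) + 1 \<le> real (card B)" using insert.hyps by simp
        qed (use d in auto)
        ultimately have "dist p (z + s *\<^sub>R b) \<le> r"
          using e(2) by (simp add: algebra_simps)
        then show ?thesis
          using zV bV by (simp add: subspace_add[OF V(1)] subspace_scale[OF V(1)])
      qed
      have "\<bar>F (z + c b *\<^sub>R b) - F z\<bar> \<le> M * \<bar>c b\<bar>"
        using stay r(2) M(2)[OF b] c[OF b]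
        by (intro smooth_on_bound_along_line[OF sm bV, of d]) (auto simp: subset_iff)
      also have "\<dots> \<le> M * d" using M(1) c[OF b] by simp
      finally have 1: "\<bar>F (z + c b *\<^sub>R b) - F z\<bar> \<le> M * d" .
      have "x + (\<Sum>b\<in>insert b S. c b *\<^sub>R b) = z + c b *\<^sub>R b"
        using insert.hyps by (simp add: z_def add_ac)
      moreover have "\<bar>F z - F x\<bar> \<le> real (card S) * (M * d)"
        unfolding z_def using insert.IH S .
      ultimately have "\<bar>F (x + (\<Sum>b\<in>insert b S. c b *\<^sub>R b)) - F x\<bar> \<le> M * d + real (card S) * (M * d)"
        using 1 by simp
      also have "\<dots> = real (card (insert b S)) * (M * d)"
        using insert.hyps by (simp add: distrib_right)
      finally show ?case .
    qed simp
    have "(\<Sum>b\<in>B. c b *\<^sub>R b) = y - x"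
      unfolding c_def using x y B(5) subspace_diff[OF V(1)]
      by (intro orthonormal_basis_expand[OF B(2,3) _ finB]) auto
    then show ?thesis
      using part[of B] by (simp add: d_def mult.assoc)
  qed
  with e(1) M(1) show ?thesis
    using that[of e "real (card B) * M"] by auto
qed

locale metric_manifold = smooth_manifold +
  assumes euclidean_dist: "locally_euclidean_dist A"
begin

lemma smooth_locally_lipschitz:
  assumes "smooth UNIV g"
  obtains W M where "open W" "x\<^sub>0 \<in> W" "M \<ge> 0"
    "\<And>x y. x \<in> W \<Longrightarrow> y \<in> W \<Longrightarrow> \<bar>g y - g x\<bar> \<le> M * dist x y"
proof -
  obtain U \<phi> where c: "(U, \<phi>) \<in> A" and x0: "x\<^sub>0 \<in> U" by (rule chart_cover)
  obtain W C where W: "open W" "x\<^sub>0 \<in> W" "W \<subseteq> U" "C > 0"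
    "\<forall>x\<in>W. \<forall>y\<in>W. dist (\<phi> x) (\<phi> y) \<le> C * dist x y \<and> dist x y \<le> C * dist (\<phi> x) (\<phi> y)"
    using bspec[OF bspec[OF euclidean_dist[unfolded locally_euclidean_dist_def] c, unfolded prod.case] x0]
    by (elim exE conjE)
  obtain e M where eM: "e > 0" "M \<ge> 0"
    "\<And>p q. p \<in> ball (\<phi> x\<^sub>0) e \<inter> V \<Longrightarrow> q \<in> ball (\<phi> x\<^sub>0) e \<inter> V \<Longrightarrow>
      \<bar>(g \<circ> inv_into U \<phi>) q - (g \<circ> inv_into U \<phi>) p\<bar> \<le> M * dist p q"
    using smooth_on_locally_lipschitz[OF subspace_V chart_image_openin[OF c], of "g \<circ> inv_into U \<phi>" "\<phi> x\<^sub>0"]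
      smoothD[OF assms c] x0 by (metis image_eqI inf_top_right)
  let ?W = "W \<inter> \<phi> -` ball (\<phi> x\<^sub>0) e"
  have "open ?W"
    by (rule continuous_open_preimage[OF continuous_on_subset[OF chart_continuous[OF c] W(3)] W(1)]) simp
  moreover have "x\<^sub>0 \<in> ?W" using W(2) eM(1) by simp
  moreover have "\<bar>g y - g x\<bar> \<le> (M * C) * dist x y" if "x \<in> ?W" "y \<in> ?W" for x y
  proof -
    have "x \<in> U" "y \<in> U" using that W(3) by auto
    then have "\<bar>g y - g x\<bar> \<le> M * dist (\<phi> x) (\<phi> y)"
      using eM(3)[of "\<phi> x" "\<phi> y"] that chart_image_in[OF c] chart_inv[OF c] by simp
    also have "\<dots> \<le> M * (C * dist x y)"
      using W(5) that eM(2) by (intro mult_left_mono) auto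
    finally show ?thesis by (simp add: mult.assoc)
  qed
  ultimately show ?thesis
    using that[of ?W "M * C"] eM(2) W(4) by simp
qed

text \<open>
  At a point with \<open>d(x\<^sub>0, Z) > 0\<close> both sides are continuous and the right one is positive, which also covers
  empty \<open>Z\<close>.  At a limit point of \<open>Z\<close>, compare \<open>g x\<close> with the value 0 at a nearly closest point of \<open>Z\<close>.
\<close>

lemma vanishing_locally_le_dist:
  assumes g: "smooth UNIV g" and zero: "\<And>z. z \<in> Z \<Longrightarrow> g z = 0"
  obtains W C where "open W" "x\<^sub>0 \<in> W" "C \<ge> 0" "\<And>x. x \<in> W \<Longrightarrow> \<bar>g x\<bar> \<le> C * dist_to x Z"
proof -
  have cont: "continuous_on UNIV (\<lambda>x. dist_to x Z)"
    unfolding dist_to_def by (cases "Z = {}") (auto intro!: continuous_intros)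
  have contg: "continuous_on UNIV g" by (rule smooth_continuous[OF open_UNIV g])
  have nonneg: "dist_to x Z \<ge> 0" for x by (simp add: dist_to_def infdist_nonneg)
  show ?thesis
  proof (cases "dist_to x\<^sub>0 Z = 0")
    case False
    define \<delta> where "\<delta> = dist_to x\<^sub>0 Z / 2"
    have \<delta>: "\<delta> > 0" using False nonneg[of x\<^sub>0] by (simp add: \<delta>_def)
    let ?W = "{x. \<delta> < dist_to x Z} \<inter> {x. \<bar>g x\<bar> < \<bar>g x\<^sub>0\<bar> + 1}"
    have "open ?W"
      by (intro open_Int open_Collect_less) (auto intro!: continuous_intros cont contg)
    moreover have "x\<^sub>0 \<in> ?W" using \<delta> by (simp add: \<delta>_def)
    moreover have "\<bar>g x\<bar> \<le> ((\<bar>g x\<^sub>0\<bar> + 1) / \<delta>) * dist_to x Z" if "x \<in> ?W" for x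
    proof -
      have "\<bar>g x\<bar> \<le> ((\<bar>g x\<^sub>0\<bar> + 1) / \<delta>) * \<delta>" using that \<delta> by simp
      also have "\<dots> \<le> ((\<bar>g x\<^sub>0\<bar> + 1) / \<delta>) * dist_to x Z"
        using that \<delta> by (intro mult_left_mono) auto
      finally show ?thesis .
    qed
    ultimately show ?thesis
      using that[of ?W "(\<bar>g x\<^sub>0\<bar> + 1) / \<delta>"] \<delta> by simp
  next
    case True
    then have Z: "Z \<noteq> {}" and x0: "infdist x\<^sub>0 Z = 0" by (auto simp: dist_to_def split: if_splits)
    obtain W M where W: "open W" "x\<^sub>0 \<in> W" "M \<ge> 0"
      "\<And>x y. x \<in> W \<Longrightarrow> y \<in> W \<Longrightarrow> \<bar>g y - g x\<bar> \<le> M * dist x y"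
      using smooth_locally_lipschitz[OF g] by metis
    obtain e where e: "e > 0" "ball x\<^sub>0 (2 * e) \<subseteq> W"
      using W(1,2) openE[OF W(1,2)] by (metis field_sum_of_halves half_gt_zero mult_2)
    have "\<bar>g x\<bar> \<le> M * infdist x Z" if x: "x \<in> ball x\<^sub>0 e" for x
    proof (rule field_le_epsilon)
      fix \<eta> :: real assume \<eta>: "\<eta> > 0"
      have lt: "infdist x Z < e"
        using infdist_triangle[of x Z x\<^sub>0] x x0 by (simp add: dist_commute)
      \<comment> \<open>The first bound keeps the nearly closest point in the ball \<open>B(x\<^sub>0, 2e)\<close>, where \<open>g\<close> is Lipschitz.\<close>
      define \<rho> where "\<rho> = min (e - infdist x Z) (\<eta> / (M + 1))"
      have \<rho>: "\<rho> > 0" "\<rho> \<le> e - infdist x Z" "M * \<rho> \<le> \<eta>"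
      proof -
        show "\<rho> > 0" using lt \<eta> W(3) by (simp add: \<rho>_def)
        have "M * \<rho> \<le> (M + 1) * (\<eta> / (M + 1))"
          using W(3) \<eta> \<open>\<rho> > 0\<close> by (intro mult_mono) (auto simp: \<rho>_def)
        then show "M * \<rho> \<le> \<eta>" using W(3) by simp
      qed (simp add: \<rho>_def)
      obtain z where z: "z \<in> Z" "dist x z < infdist x Z + \<rho>"
        using cINF_less_iff[OF Z bdd_below_image_dist, of x "infdist x Z + \<rho>"] \<rho>(1)
        by (auto simp: infdist_notempty[OF Z])
      have "dist x\<^sub>0 z < 2 * e"
        using dist_triangle[of x\<^sub>0 z x] x z(2) \<rho>(2) by simp
      then have "z \<in> W" "x \<in> W" using e x by auto
      then have "\<bar>g x\<bar> \<le> M * dist x z"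
        using W(4)[of x z] zero[OF z(1)] by simp
      also have "\<dots> \<le> M * (infdist x Z + \<rho>)" using z(2) W(3) by (intro mult_left_mono) auto
      also have "\<dots> \<le> M * infdist x Z + \<eta>" using \<rho>(3) by (simp add: algebra_simps)
      finally show "\<bar>g x\<bar> \<le> M * infdist x Z + \<eta>" .
    qed
    then show ?thesis
      using that[of "ball x\<^sub>0 e" M] e(1) W(3) Z by (simp add: dist_to_def)
  qed
qed

lemma vanishing_le_dist_on_compact:
  assumes g: "smooth UNIV g" and zero: "\<And>z. z \<in> Z \<Longrightarrow> g z = 0" and K: "compact K"
  obtains C where "C \<ge> 0" "\<And>x. x \<in> K \<Longrightarrow> \<bar>g x\<bar> \<le> C * dist_to x Z"
proof -
  have "\<exists>W C. open W \<and> y \<in> W \<and> C \<ge> 0 \<and> (\<forall>x\<in>W. \<bar>g x\<bar> \<le> C * dist_to x Z)" for y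
    using vanishing_locally_le_dist[OF g zero, of Z y] by metis
  then obtain W C where W: "\<And>y. open (W y)" "\<And>y. y \<in> W y" "\<And>y. C y \<ge> 0"
    "\<And>y x. x \<in> W y \<Longrightarrow> \<bar>g x\<bar> \<le> C y * dist_to x Z"
    by metis
  obtain D where D: "D \<subseteq> K" "finite D" "K \<subseteq> (\<Union>y\<in>D. W y)"
    using compactE_image[OF K, of K W] W by blast
  have "\<bar>g x\<bar> \<le> sum C D * dist_to x Z" if x: "x \<in> K" for x
  proof -
    obtain y where y: "y \<in> D" "x \<in> W y" using D(3) x by blast
    have "C y * dist_to x Z \<le> sum C D * dist_to x Z"
      using y(1) D(2) W(3) by (intro mult_right_mono member_le_sum) (auto simp: dist_to_def infdist_nonneg)
    then show ?thesis using W(4)[OF y(2)] by linarith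
  qed
  then show ?thesis using that[of "sum C D"] W(3) by (simp add: sum_nonneg)
qed

end

section \<open>Ideals of smooth functions and the Lojasiewicz radical\<close>

lemma power_add_le_even:
  fixes a b :: real
  shows "(a + b) ^ (2 * n) \<le> 2 ^ (2 * n) * (a ^ (2 * n) + b ^ (2 * n))"
proof -
  let ?m = "max \<bar>a\<bar> \<bar>b\<bar>"
  have "(a + b) ^ (2 * n) = \<bar>a + b\<bar> ^ (2 * n)" by (simp add: power_even_abs)
  also have "\<dots> \<le> (2 * ?m) ^ (2 * n)" by (rule power_mono) auto
  also have "\<dots> = 2 ^ (2 * n) * ?m ^ (2 * n)" by (rule power_mult_distrib)
  also have "\<dots> \<le> 2 ^ (2 * n) * (a ^ (2 * n) + b ^ (2 * n))"
  proof (rule mult_left_mono)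
    have "?m ^ (2 * n) = a ^ (2 * n) \<or> ?m ^ (2 * n) = b ^ (2 * n)"
      by (auto simp: max_def power_even_abs)
    moreover have "0 \<le> a ^ (2 * n)" "0 \<le> b ^ (2 * n)" by simp_all
    ultimately show "?m ^ (2 * n) \<le> a ^ (2 * n) + b ^ (2 * n)" by linarith
  qed simp
  finally show ?thesis .
qed

context smooth_manifold
begin

lemma smooth_ring_simps:
  "carrier (smooth_ring V A) = {f. smooth UNIV f}"
  "f \<otimes>\<^bsub>smooth_ring V A\<^esub> g = (\<lambda>x. f x * g x)"
  "f \<oplus>\<^bsub>smooth_ring V A\<^esub> g = (\<lambda>x. f x + g x)"
  "\<one>\<^bsub>smooth_ring V A\<^esub> = (\<lambda>x. 1)"
  "\<zero>\<^bsub>smooth_ring V A\<^esub> = (\<lambda>x. 0)"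
  by (simp_all add: smooth_ring_def)

lemma
  assumes "ideal \<bb> (smooth_ring V A)"
  shows smooth_ideal_smooth: "f \<in> \<bb> \<Longrightarrow> smooth UNIV f"
    and smooth_ideal_zero: "(\<lambda>x. 0) \<in> \<bb>"
    and smooth_ideal_add: "f \<in> \<bb> \<Longrightarrow> g \<in> \<bb> \<Longrightarrow> (\<lambda>x. f x + g x) \<in> \<bb>"
    and smooth_ideal_mult: "smooth UNIV h \<Longrightarrow> f \<in> \<bb> \<Longrightarrow> (\<lambda>x. h x * f x) \<in> \<bb>"
proof -
  interpret ideal \<bb> "smooth_ring V A" by fact
  show "f \<in> \<bb> \<Longrightarrow> smooth UNIV f" "(\<lambda>x. 0) \<in> \<bb>"
    "f \<in> \<bb> \<Longrightarrow> g \<in> \<bb> \<Longrightarrow> (\<lambda>x. f x + g x) \<in> \<bb>"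
    "smooth UNIV h \<Longrightarrow> f \<in> \<bb> \<Longrightarrow> (\<lambda>x. h x * f x) \<in> \<bb>"
    using Icarr[of f] additive_subgroup.zero_closed[OF additive_subgroup_axioms]
      additive_subgroup.a_closed[OF additive_subgroup_axioms, of f g] I_l_closed[of f h]
    by (auto simp: smooth_ring_simps)
qed

lemma smooth_ideal_power:
  assumes "ideal \<bb> (smooth_ring V A)" "f \<in> \<bb>" "n \<ge> 1"
  shows "(\<lambda>x. f x ^ n) \<in> \<bb>"
proof -
  have "(\<lambda>x. f x ^ (n - 1) * f x) \<in> \<bb>"
    using smooth_ideal_mult[OF assms(1) smooth_power[OF open_UNIV smooth_ideal_smooth] assms(2)] assms by blast
  also have "(\<lambda>x. f x ^ (n - 1) * f x) = (\<lambda>x. f x ^ n)"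
    using assms(3) by (intro ext power_minus_mult) simp
  finally show ?thesis .
qed

text \<open>
  For a sum, bring the inequalities that bound \<open>g\<^sub>1\<close> and \<open>g\<^sub>2\<close> to the common exponent \<open>2 m\<^sub>1 m\<^sub>2\<close> by taking powers and use
  \<open>power_add_le_even\<close>.
\<close>

lemma loj_radical_ideal:
  assumes \<aa>: "ideal \<aa> (smooth_ring V A)"
  shows "ideal (loj_radical V A \<aa>) (smooth_ring V A)"
proof -
  interpret ideal \<aa> "smooth_ring V A" by fact
  let ?R = "loj_radical V A \<aa>"
  have memI: "g \<in> ?R" if "smooth UNIV g" "f \<in> \<aa>" "m \<ge> 1" "\<And>x. g x ^ (2 * m) \<le> f x" for f g m
    using that unfolding loj_radical_def by (auto simp: smooth_ring_simps)
  have memE: "\<exists>f\<in>\<aa>. \<exists>m\<ge>1. smooth UNIV g \<and> (\<forall>x. g x ^ (2 * m) \<le> f x)" if "g \<in> ?R" for g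
    using that unfolding loj_radical_def by (auto simp: smooth_ring_simps)
  have mult: "(\<lambda>x. h x * g x) \<in> ?R" if h: "smooth UNIV h" and g: "g \<in> ?R" for g h
  proof -
    obtain f m where fm: "f \<in> \<aa>" "m \<ge> 1" "smooth UNIV g" "\<And>x. g x ^ (2 * m) \<le> f x"
      using memE[OF g] by auto
    have "(\<lambda>x. h x ^ (2 * m) * f x) \<in> \<aa>"
      using smooth_ideal_mult[OF \<aa> smooth_power[OF open_UNIV h] fm(1)] .
    then show ?thesis
    proof (rule memI[OF smooth_mult[OF open_UNIV h fm(3)] _ fm(2)])
      show "(h x * g x) ^ (2 * m) \<le> h x ^ (2 * m) * f x" for x
        using fm(4)[of x] by (simp add: power_mult_distrib mult_left_mono)
    qed
  qed
  have mult': "(\<lambda>x. g x * h x) \<in> ?R" if "smooth UNIV h" "g \<in> ?R" for g h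
    using mult[OF that] by (simp add: mult.commute)
  have add: "(\<lambda>x. g\<^sub>1 x + g\<^sub>2 x) \<in> ?R" if g: "g\<^sub>1 \<in> ?R" "g\<^sub>2 \<in> ?R" for g\<^sub>1 g\<^sub>2
  proof -
    obtain f\<^sub>1 m\<^sub>1 where 1: "f\<^sub>1 \<in> \<aa>" "m\<^sub>1 \<ge> 1" "smooth UNIV g\<^sub>1" "\<And>x. g\<^sub>1 x ^ (2 * m\<^sub>1) \<le> f\<^sub>1 x"
      using memE[OF g(1)] by auto
    obtain f\<^sub>2 m\<^sub>2 where 2: "f\<^sub>2 \<in> \<aa>" "m\<^sub>2 \<ge> 1" "smooth UNIV g\<^sub>2" "\<And>x. g\<^sub>2 x ^ (2 * m\<^sub>2) \<le> f\<^sub>2 x"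
      using memE[OF g(2)] by auto
    let ?m = "m\<^sub>1 * m\<^sub>2"
    let ?f = "\<lambda>x. 2 ^ (2 * ?m) * (f\<^sub>1 x ^ m\<^sub>2 + f\<^sub>2 x ^ m\<^sub>1)"
    have "?f \<in> \<aa>"
      by (intro smooth_ideal_mult[OF \<aa>] smooth_const smooth_ideal_add[OF \<aa>] smooth_ideal_power[OF \<aa>]
          1 2 open_UNIV)
    then show ?thesis
    proof (rule memI[OF smooth_add[OF open_UNIV 1(3) 2(3)]])
      show "(g\<^sub>1 x + g\<^sub>2 x) ^ (2 * ?m) \<le> ?f x" for x
      proof -
        have "(g\<^sub>1 x ^ (2 * m\<^sub>1)) ^ m\<^sub>2 \<le> f\<^sub>1 x ^ m\<^sub>2"
          by (rule power_mono[OF 1(4)]) simp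
        then have "g\<^sub>1 x ^ (2 * ?m) \<le> f\<^sub>1 x ^ m\<^sub>2" by (simp add: power_mult[symmetric] mult.assoc)
        moreover have "(g\<^sub>2 x ^ (2 * m\<^sub>2)) ^ m\<^sub>1 \<le> f\<^sub>2 x ^ m\<^sub>1"
          by (rule power_mono[OF 2(4)]) simp
        then have "g\<^sub>2 x ^ (2 * ?m) \<le> f\<^sub>2 x ^ m\<^sub>1" by (simp add: power_mult[symmetric] ac_simps)
        ultimately have "2 ^ (2 * ?m) * (g\<^sub>1 x ^ (2 * ?m) + g\<^sub>2 x ^ (2 * ?m)) \<le> ?f x"
          by (intro mult_left_mono add_mono) auto
        then show ?thesis using power_add_le_even[of "g\<^sub>1 x" "g\<^sub>2 x" ?m] by linarith
      qed
    qed (use 1 2 in simp)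
  qed
  have neg: "\<ominus>\<^bsub>smooth_ring V A\<^esub> g = (\<lambda>x. - 1 * g x)" if "smooth UNIV g" for g
    by (rule minus_equality)
       (use that in \<open>auto simp: smooth_ring_simps intro: smooth_minus\<close>)
  show ?thesis
  proof (rule idealI)
    show "ring (smooth_ring V A)" by (rule ring_axioms)
    show "subgroup ?R (add_monoid (smooth_ring V A))"
    proof
      show "?R \<subseteq> carrier (add_monoid (smooth_ring V A))"
        by (auto simp: loj_radical_def)
      show "\<one>\<^bsub>add_monoid (smooth_ring V A)\<^esub> \<in> ?R"
        using memI[OF smooth_const[OF open_UNIV, of 0] smooth_ideal_zero[OF \<aa>], of 1] by (simp add: smooth_ring_simps)
      show "f \<otimes>\<^bsub>add_monoid (smooth_ring V A)\<^esub> g \<in> ?R" if "f \<in> ?R" "g \<in> ?R" for f g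
        using add[OF that] by (simp add: smooth_ring_simps)
      show "inv\<^bsub>add_monoid (smooth_ring V A)\<^esub> g \<in> ?R" if "g \<in> ?R" for g
        using mult[OF smooth_const[OF open_UNIV, of "- 1"] that] neg[of g] that
        by (simp add: a_inv_def loj_radical_def smooth_ring_simps)
    qed
  qed (use mult mult' in \<open>simp_all add: smooth_ring_simps\<close>)
qed

end

section \<open>The ring of germs at a point\<close>

lemma germ_eq_iff: "germ x f = germ x g \<longleftrightarrow> (\<forall>\<^sub>F y in nhds x. f y = g y)"
proof
  assume "germ x f = germ x g"
  moreover have "f \<in> germ x f" by (simp add: germ_def)
  ultimately show "\<forall>\<^sub>F y in nhds x. f y = g y" by (auto simp: germ_def)
next
  assume *: "\<forall>\<^sub>F y in nhds x. f y = g y"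
  show "germ x f = germ x g"
    unfolding germ_def
  proof (intro Collect_cong iffI)
    fix h
    show "\<forall>\<^sub>F y in nhds x. h y = g y" if "\<forall>\<^sub>F y in nhds x. h y = f y"
      using that * by eventually_elim simp
    show "\<forall>\<^sub>F y in nhds x. h y = f y" if "\<forall>\<^sub>F y in nhds x. h y = g y"
      using that * by eventually_elim simp
  qed
qed

lemma germ_value: "germ x f = germ x g \<Longrightarrow> f x = g x"
  unfolding germ_eq_iff by (rule eventually_nhds_x_imp_x)

text \<open>
  The ring operations on germs are defined through arbitrary representatives; they can be
  computed on any two of them.
\<close>

lemma germ_lift2:
  "{h. \<exists>f'\<in>germ x f. \<exists>g'\<in>germ x g. \<forall>\<^sub>F y in nhds x. h y = b (f' y) (g' y)} =
   germ x (\<lambda>y. b (f y) (g y))"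
proof -
  have "(\<exists>f'\<in>germ x f. \<exists>g'\<in>germ x g. \<forall>\<^sub>F y in nhds x. h y = b (f' y) (g' y)) \<longleftrightarrow>
      (\<forall>\<^sub>F y in nhds x. h y = b (f y) (g y))" (is "?L \<longleftrightarrow> ?R") for h
  proof
    assume ?L
    then obtain f' g' where "\<forall>\<^sub>F y in nhds x. f' y = f y" "\<forall>\<^sub>F y in nhds x. g' y = g y"
      "\<forall>\<^sub>F y in nhds x. h y = b (f' y) (g' y)"
      unfolding germ_def by blast
    then show ?R by eventually_elim simp
  next
    assume ?R
    moreover have "f \<in> germ x f" "g \<in> germ x g" by (simp_all add: germ_def)
    ultimately show ?L by blast
  qed
  then show ?thesis by (simp add: germ_def)
qed

context smooth_manifold
begin

lemma germ_ring_mult: "germ x f \<otimes>\<^bsub>germ_ring V A x\<^esub> germ x g = germ x (\<lambda>y. f y * g y)"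
  by (simp add: germ_ring_def germ_lift2)

lemma germ_ring_add: "germ x f \<oplus>\<^bsub>germ_ring V A x\<^esub> germ x g = germ x (\<lambda>y. f y + g y)"
  by (simp add: germ_ring_def germ_lift2)

lemma germ_ring_zero: "\<zero>\<^bsub>germ_ring V A x\<^esub> = germ x (\<lambda>y. 0)"
  by (simp add: germ_ring_def)

lemma germ_ring_one: "\<one>\<^bsub>germ_ring V A x\<^esub> = germ x (\<lambda>y. 1)"
  by (simp add: germ_ring_def)

definition local_smooth :: "'a \<Rightarrow> ('a \<Rightarrow> real) \<Rightarrow> bool" where
  "local_smooth x f \<longleftrightarrow> (\<exists>N. open N \<and> x \<in> N \<and> smooth N f)"

lemma local_smooth_const: "local_smooth x (\<lambda>y. c)"
  unfolding local_smooth_def using smooth_const[OF open_UNIV] by blast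

lemma local_smooth_add: "local_smooth x f \<Longrightarrow> local_smooth x g \<Longrightarrow> local_smooth x (\<lambda>y. f y + g y)"
  and local_smooth_mult: "local_smooth x f \<Longrightarrow> local_smooth x g \<Longrightarrow> local_smooth x (\<lambda>y. f y * g y)"
proof -
  assume "local_smooth x f" "local_smooth x g"
  then obtain M N where "open M" "x \<in> M" "smooth M f" "open N" "x \<in> N" "smooth N g"
    unfolding local_smooth_def by blast
  then have *: "open (M \<inter> N)" "x \<in> M \<inter> N" "smooth (M \<inter> N) f" "smooth (M \<inter> N) g"
    by (auto intro: smooth_subset)
  show "local_smooth x (\<lambda>y. f y + g y)"
    unfolding local_smooth_def by (intro exI[of _ "M \<inter> N"] conjI * smooth_add)
  show "local_smooth x (\<lambda>y. f y * g y)"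
    unfolding local_smooth_def by (intro exI[of _ "M \<inter> N"] conjI * smooth_mult)
qed

lemma local_smooth_minus: "local_smooth x f \<Longrightarrow> local_smooth x (\<lambda>y. - f y)"
  unfolding local_smooth_def using smooth_minus by blast

lemma germ_ring_carrier_eq: "carrier (germ_ring V A x) = {germ x f | f. local_smooth x f}"
  by (auto simp: germ_ring_def local_smooth_def)

lemmas local_smooth_intros = local_smooth_const local_smooth_add local_smooth_mult local_smooth_minus

lemma germ_in_carrier: "local_smooth x f \<Longrightarrow> germ x f \<in> carrier (germ_ring V A x)"
  unfolding germ_ring_carrier_eq by blast

lemma germ_ring_carrierE:
  assumes "F \<in> carrier (germ_ring V A x)"
  obtains f where "F = germ x f" "local_smooth x f"
  using assms unfolding germ_ring_carrier_eq by blast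

text \<open>
  The ideal generated by a set is the intersection of all ideals containing it, where being an ideal
  includes that the ambient structure is a ring.  Without the ring axioms for germs the
  intersection would be over the empty family.
\<close>

lemma ring_germ_ring: "ring (germ_ring V A x)"
proof (rule ringI)
  let ?G = "germ_ring V A x"
  show "abelian_group ?G"
  proof (rule abelian_groupI)
    show "\<exists>Y\<in>carrier ?G. Y \<oplus>\<^bsub>?G\<^esub> X = \<zero>\<^bsub>?G\<^esub>" if X: "X \<in> carrier ?G" for X
    proof -
      obtain f where f: "X = germ x f" "local_smooth x f" using germ_ring_carrierE[OF X] by metis
      show ?thesis
        by (rule bexI[OF _ germ_in_carrier[OF local_smooth_minus[OF f(2)]]])
           (simp add: f(1) germ_ring_add germ_ring_zero)
    qed
  qed (auto elim!: germ_ring_carrierE intro!: germ_in_carrier local_smooth_intros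
        simp: germ_ring_add germ_ring_zero ac_simps)
  show "monoid ?G"
    by (rule monoidI) (auto elim!: germ_ring_carrierE intro!: germ_in_carrier local_smooth_intros
        simp: germ_ring_mult germ_ring_one ac_simps)
qed (auto elim!: germ_ring_carrierE simp: germ_ring_mult germ_ring_add algebra_simps)

text \<open>
  At a point of \<open>Z\<close>, this ideal bounds the ideal generated by the germs of functions vanishing on \<open>Z\<close>.
\<close>

lemma vanishing_germs_ideal:
  "ideal {germ x f | f. local_smooth x f \<and> f x = 0} (germ_ring V A x)" (is "ideal ?J ?G")
proof -
  interpret G: ring ?G by (rule ring_germ_ring)
  have JI: "germ x f \<in> ?J" if "local_smooth x f" "f x = 0" for f using that by blast
  have JE: "\<exists>f. F = germ x f \<and> local_smooth x f \<and> f x = 0" if "F \<in> ?J" for F using that by blast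
  show ?thesis
  proof (rule idealI[OF ring_germ_ring])
    show "subgroup ?J (add_monoid ?G)"
    proof
      show "?J \<subseteq> carrier (add_monoid ?G)" by (auto simp: germ_ring_carrier_eq)
      show "\<one>\<^bsub>add_monoid ?G\<^esub> \<in> ?J"
        using JI[of "\<lambda>y. 0"] by (simp add: germ_ring_zero local_smooth_const)
      fix F assume "F \<in> ?J"
      then obtain f where f: "F = germ x f" "local_smooth x f" "f x = 0" using JE by blast
      have "\<ominus>\<^bsub>?G\<^esub> F = germ x (\<lambda>y. - f y)"
        by (rule G.minus_equality)
           (auto simp: f germ_ring_add germ_ring_zero intro!: germ_in_carrier local_smooth_minus)
      then show "inv\<^bsub>add_monoid ?G\<^esub> F \<in> ?J"
        using JI[of "\<lambda>y. - f y"] f by (simp add: a_inv_def local_smooth_minus)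
      fix H assume "H \<in> ?J"
      then obtain h where h: "H = germ x h" "local_smooth x h" "h x = 0" using JE by blast
      show "F \<otimes>\<^bsub>add_monoid ?G\<^esub> H \<in> ?J"
        using JI[of "\<lambda>y. f y + h y"] f h by (simp add: germ_ring_add local_smooth_add)
    qed
    fix F H assume F: "F \<in> ?J" and H: "H \<in> carrier ?G"
    obtain f where "F = germ x f" "local_smooth x f" "f x = 0" using JE[OF F] by blast
    moreover obtain h where "H = germ x h" "local_smooth x h" using germ_ring_carrierE[OF H] by metis
    ultimately show "H \<otimes>\<^bsub>?G\<^esub> F \<in> ?J" "F \<otimes>\<^bsub>?G\<^esub> H \<in> ?J"
      using JI[of "\<lambda>y. h y * f y"] JI[of "\<lambda>y. f y * h y"] by (simp_all add: germ_ring_mult local_smooth_mult)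
  qed
qed

end

section \<open>Three hulls of a set of functions vanishing on Z\<close>

context smooth_manifold
begin

lemma smooth_topology_open_iff:
  "openin (smooth_topology V A) T \<longleftrightarrow> generate_topology_on
     {{g \<in> carrier (smooth_ring V A). \<forall>x\<in>K.
         \<bar>iter_deriv vs (g \<circ> inv_into U \<phi>) (\<phi> x) - iter_deriv vs (f \<circ> inv_into U \<phi>) (\<phi> x)\<bar> < \<epsilon>}
      | f U \<phi> K vs \<epsilon>.
        f \<in> carrier (smooth_ring V A) \<and> (U, \<phi>) \<in> A \<and> compact K \<and> K \<subseteq> U \<and> vs \<in> lists V \<and> \<epsilon> > 0} T"
  unfolding smooth_topology_def by (rule openin_topology_generated_by_iff)

lemma smooth_topology_basic_open:
  assumes "smooth UNIV f" "(U, \<phi>) \<in> A" "compact K" "K \<subseteq> U" "vs \<in> lists V" "\<epsilon> > 0"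
  shows "openin (smooth_topology V A) {g \<in> carrier (smooth_ring V A). \<forall>x\<in>K.
      \<bar>iter_deriv vs (g \<circ> inv_into U \<phi>) (\<phi> x) - iter_deriv vs (f \<circ> inv_into U \<phi>) (\<phi> x)\<bar> < \<epsilon>}"
  unfolding smooth_topology_open_iff
  by (intro generate_topology_on.Basis CollectI exI conjI, rule refl)
     (use assms in \<open>simp_all add: smooth_ring_simps\<close>)

lemma iter_deriv_chart_cong:
  assumes c: "(U, \<phi>) \<in> A" and x: "x \<in> U" and W: "open W" "x \<in> W" "\<forall>y\<in>W. h y = g y"
    and vs: "vs \<in> lists V"
  shows "iter_deriv vs (h \<circ> inv_into U \<phi>) (\<phi> x) = iter_deriv vs (g \<circ> inv_into U \<phi>) (\<phi> x)"
  by (rule iter_deriv_cong[OF subspace_V chart_image_open[OF c W(1)] vs])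
     (use x W chart_inv[OF c] in auto)

text \<open>
  A neighbourhood of \<open>g\<close> is determined by finitely many compact sets, on which only derivatives
  are compared; a function that agrees with \<open>g\<close> near their union has the same derivatives there.
\<close>

lemma smooth_topology_local:
  assumes "openin (smooth_topology V A) T" "g \<in> T"
  shows "\<exists>K. compact K \<and>
    (\<forall>h W. smooth UNIV h \<longrightarrow> open W \<longrightarrow> K \<subseteq> W \<longrightarrow> (\<forall>x\<in>W. h x = g x) \<longrightarrow> h \<in> T)"
  using assms unfolding smooth_topology_open_iff
proof (induction rule: generate_topology_on.induct)
  case (Int T\<^sub>1 T\<^sub>2)
  obtain K\<^sub>1 where 1: "compact K\<^sub>1"
    "\<forall>h W. smooth UNIV h \<longrightarrow> open W \<longrightarrow> K\<^sub>1 \<subseteq> W \<longrightarrow> (\<forall>x\<in>W. h x = g x) \<longrightarrow> h \<in> T\<^sub>1"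
    using Int.IH(1)[OF IntD1[OF Int.prems]] by (elim exE conjE)
  obtain K\<^sub>2 where 2: "compact K\<^sub>2"
    "\<forall>h W. smooth UNIV h \<longrightarrow> open W \<longrightarrow> K\<^sub>2 \<subseteq> W \<longrightarrow> (\<forall>x\<in>W. h x = g x) \<longrightarrow> h \<in> T\<^sub>2"
    using Int.IH(2)[OF IntD2[OF Int.prems]] by (elim exE conjE)
  show ?case
    by (rule exI[of _ "K\<^sub>1 \<union> K\<^sub>2"]) (use 1 2 in \<open>simp add: compact_Un\<close>)
next
  case (UN \<T>)
  obtain T where T: "T \<in> \<T>" "g \<in> T" using UN.prems by (rule UnionE)
  obtain K where K: "compact K"
    "\<forall>h W. smooth UNIV h \<longrightarrow> open W \<longrightarrow> K \<subseteq> W \<longrightarrow> (\<forall>x\<in>W. h x = g x) \<longrightarrow> h \<in> T"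
    using UN.IH[OF T] by (elim exE conjE)
  show ?case
    by (rule exI[of _ K]) (use K T(1) in auto)
next
  case (Basis T)
  then obtain f U \<phi> K vs \<epsilon> where T: "T = {g \<in> carrier (smooth_ring V A). \<forall>x\<in>K.
      \<bar>iter_deriv vs (g \<circ> inv_into U \<phi>) (\<phi> x) - iter_deriv vs (f \<circ> inv_into U \<phi>) (\<phi> x)\<bar> < \<epsilon>}"
    and c: "(U, \<phi>) \<in> A" and K: "compact K" "K \<subseteq> U" and vs: "vs \<in> lists V"
    by (elim CollectE exE conjE)
  show ?case
  proof (intro exI[of _ K] conjI allI impI K(1))
    fix h W assume h: "smooth UNIV h" "open W" "K \<subseteq> W" "\<forall>x\<in>W. h x = g x"
    have "iter_deriv vs (h \<circ> inv_into U \<phi>) (\<phi> x) = iter_deriv vs (g \<circ> inv_into U \<phi>) (\<phi> x)"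
      if "x \<in> K" for x
      using iter_deriv_chart_cong[OF c _ h(2) _ h(4) vs] that K(2) h(3) by blast
    then show "h \<in> T"
      using Basis.prems h(1) unfolding T by (simp add: smooth_ring_simps)
  qed
qed simp

lemma smooth_topology_topspace: "topspace (smooth_topology V A) = {f. smooth UNIV f}"
proof
  show "topspace (smooth_topology V A) \<subseteq> {f. smooth UNIV f}"
    unfolding smooth_topology_def topology_generated_by_topspace by (auto simp: smooth_ring_simps)
  show "{f. smooth UNIV f} \<subseteq> topspace (smooth_topology V A)"
  proof
    fix f assume "f \<in> {f. smooth UNIV f}"
    obtain U \<phi> where "(U, \<phi>) \<in> A" by (rule chart_cover)
    then show "f \<in> topspace (smooth_topology V A)"
      using openin_subset[OF smooth_topology_basic_open[of f U \<phi> "{}" "[]" 1]]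
        \<open>f \<in> {f. smooth UNIV f}\<close> by (auto simp: smooth_ring_simps)
  qed
qed

text \<open>
  If a set \<open>\<bb>\<close> of functions vanishing on \<open>Z\<close> agrees near every compact set with each such function, then
  its saturation, Whitney closure and closure all equal the ideal of \<open>Z\<close>: one inclusion
  holds because membership in each hull is tested near compact sets, the other because
  each test detects the value at a point of \<open>Z\<close>.
\<close>

context
  fixes Z :: "'a set" and \<bb> :: "('a \<Rightarrow> real) set"
  assumes vanish: "\<bb> \<subseteq> vanishing_ideal V A Z"
    and agree: "\<And>g K. g \<in> vanishing_ideal V A Z \<Longrightarrow> compact K \<Longrightarrow>
      \<exists>h\<in>\<bb>. \<exists>W. open W \<and> K \<subseteq> W \<and> (\<forall>x\<in>W. h x = g x)"
begin

lemma agree_at: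
  assumes "g \<in> vanishing_ideal V A Z"
  obtains h W where "h \<in> \<bb>" "open W" "x \<in> W" "\<forall>y\<in>W. h y = g y"
  using agree[OF assms, of "{x}"] by auto

lemma smooth_member: "h \<in> \<bb> \<Longrightarrow> smooth UNIV h" and zero_member: "h \<in> \<bb> \<Longrightarrow> z \<in> Z \<Longrightarrow> h z = 0"
  using vanish by (auto simp: vanishing_ideal_def smooth_ring_simps)

lemma saturation_eq_vanishing_ideal: "saturation V A \<bb> = vanishing_ideal V A Z"
proof (intro subset_antisym subsetI)
  fix g assume g: "g \<in> vanishing_ideal V A Z"
  have "germ x g \<in> genideal (germ_ring V A x) (germ x ` \<bb>)" for x
  proof -
    obtain h W where h: "h \<in> \<bb>" "open W" "x \<in> W" "\<forall>y\<in>W. h y = g y"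
      using agree_at[OF g] by metis
    then have "germ x h = germ x g"
      unfolding germ_eq_iff eventually_nhds by blast
    with h(1) have "germ x g \<in> germ x ` \<bb>" by (metis imageI)
    then show ?thesis unfolding genideal_def by blast
  qed
  then show "g \<in> saturation V A \<bb>"
    using g by (simp add: saturation_def vanishing_ideal_def)
next
  fix g assume g: "g \<in> saturation V A \<bb>"
  have "g z = 0" if z: "z \<in> Z" for z
  proof -
    let ?J = "{germ z f | f. local_smooth z f \<and> f z = 0}"
    have "germ z ` \<bb> \<subseteq> ?J"
      using smooth_member zero_member[OF _ z] by (auto simp: local_smooth_def)
    then have "genideal (germ_ring V A z) (germ z ` \<bb>) \<subseteq> ?J"
      unfolding genideal_def using vanishing_germs_ideal by blast
    moreover have "germ z g \<in> genideal (germ_ring V A z) (germ z ` \<bb>)"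
      using g by (simp add: saturation_def)
    ultimately obtain f where "germ z g = germ z f" "f z = 0" by blast
    then show ?thesis using germ_value by metis
  qed
  then show "g \<in> vanishing_ideal V A Z"
    using g by (simp add: saturation_def vanishing_ideal_def)
qed

lemma whitney_closure_eq_vanishing_ideal: "whitney_closure V A \<bb> = vanishing_ideal V A Z"
proof (intro subset_antisym subsetI)
  fix g assume g: "g \<in> vanishing_ideal V A Z"
  have "taylor V c x g \<in> taylor V c x ` \<bb>" if "c \<in> A" "x \<in> fst c" for x c
  proof -
    obtain U \<phi> where c: "c = (U, \<phi>)" by (cases c)
    obtain h W where h: "h \<in> \<bb>" "open W" "x \<in> W" "\<forall>y\<in>W. h y = g y"
      using agree_at[OF g] by metis
    have "iter_deriv (replicate k v) (h \<circ> inv_into U \<phi>) (\<phi> x) =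
        iter_deriv (replicate k v) (g \<circ> inv_into U \<phi>) (\<phi> x)" if "v \<in> V" for k v
      by (rule iter_deriv_chart_cong[OF _ _ h(2-4)])
         (use \<open>c \<in> A\<close> \<open>x \<in> fst c\<close> c that in \<open>auto simp: in_lists_conv_set\<close>)
    then have "taylor V c x g = taylor V c x h"
      by (intro ext) (simp add: c taylor_def restrict_def)
    then show ?thesis using h(1) by blast
  qed
  then show "g \<in> whitney_closure V A \<bb>"
    using g by (simp add: whitney_closure_def vanishing_ideal_def)
next
  fix g assume g: "g \<in> whitney_closure V A \<bb>"
  have "g z = 0" if z: "z \<in> Z" for z
  proof -
    obtain U \<phi> where c: "(U, \<phi>) \<in> A" "z \<in> U" by (rule chart_cover)
    then have "taylor V (U, \<phi>) z g \<in> taylor V (U, \<phi>) z ` \<bb>"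
      using g unfolding whitney_closure_def by force
    then obtain h where h: "h \<in> \<bb>" "taylor V (U, \<phi>) z g = taylor V (U, \<phi>) z h" by blast
    \<comment> \<open>The homogeneous component of degree 0, evaluated at the zero vector, is the value at the point.\<close>
    have "taylor V (U, \<phi>) z f 0 0 = f z" for f
      using chart_inv[OF c] subspace_0[OF subspace_V] by (simp add: taylor_def)
    then show ?thesis using h zero_member[OF h(1) z] by metis
  qed
  then show "g \<in> vanishing_ideal V A Z"
    using g by (simp add: whitney_closure_def vanishing_ideal_def)
qed

lemma smooth_closure_eq_vanishing_ideal:
  "smooth_topology V A closure_of \<bb> = vanishing_ideal V A Z"
proof (intro subset_antisym subsetI)
  fix g assume g: "g \<in> vanishing_ideal V A Z"
  have "\<exists>h\<in>\<bb>. h \<in> T" if T: "g \<in> T" "openin (smooth_topology V A) T" for T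
  proof -
    obtain K where K: "compact K"
      "\<forall>h W. smooth UNIV h \<longrightarrow> open W \<longrightarrow> K \<subseteq> W \<longrightarrow> (\<forall>x\<in>W. h x = g x) \<longrightarrow> h \<in> T"
      using smooth_topology_local[OF T(2,1)] by auto
    obtain h W where "h \<in> \<bb>" "open W" "K \<subseteq> W" "\<forall>x\<in>W. h x = g x"
      using agree[OF g K(1)] by auto
    then show ?thesis using K(2) smooth_member by blast
  qed
  then show "g \<in> smooth_topology V A closure_of \<bb>"
    using g by (auto simp: in_closure_of smooth_topology_topspace vanishing_ideal_def smooth_ring_simps)
next
  fix g assume g: "g \<in> smooth_topology V A closure_of \<bb>"
  then have sm: "smooth UNIV g" by (simp add: in_closure_of smooth_topology_topspace)
  have "g z = 0" if z: "z \<in> Z" for z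
  proof (rule ccontr)
    assume nz: "g z \<noteq> 0"
    obtain U \<phi> where c: "(U, \<phi>) \<in> A" "z \<in> U" by (rule chart_cover)
    define T where "T = {h \<in> carrier (smooth_ring V A). \<forall>x\<in>{z}.
      \<bar>iter_deriv [] (h \<circ> inv_into U \<phi>) (\<phi> x) - iter_deriv [] (g \<circ> inv_into U \<phi>) (\<phi> x)\<bar> < \<bar>g z\<bar>}"
    have "openin (smooth_topology V A) T"
      unfolding T_def using sm c nz by (intro smooth_topology_basic_open) auto
    moreover have "g \<in> T" using sm nz by (simp add: T_def smooth_ring_simps)
    ultimately obtain h where h: "h \<in> \<bb>" "h \<in> T"
      using g unfolding in_closure_of by blast
    then show False
      using zero_member[OF h(1) z] chart_inv[OF c] by (simp add: T_def)
  qed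
  then show "g \<in> vanishing_ideal V A Z"
    using sm by (simp add: vanishing_ideal_def smooth_ring_simps)
qed

end

end

section \<open>Flat-topped truncations lie in the Lojasiewicz radical\<close>

context metric_manifold
begin

text \<open>
  Raise \<open>\<bar>g\<bar> \<le> C d(x, Z)\<close> to the power \<open>m\<close> of the Lojasiewicz inequality \<open>c d(x, Z)\<^sup>m \<le> \<bar>f\<bar>\<close> and square
  the result.  Squaring replaces \<open>\<bar>f\<bar>\<close>, which need not be in the ideal, by \<open>f\<^sup>2\<close>, which is.
\<close>

lemma vanishing_compact_support_in_loj_radical:
  assumes \<aa>: "lojasiewicz_ideal V A \<aa>" and g: "g \<in> vanishing_ideal V A (zero_set \<aa>)"
    and L: "compact L" "\<And>x. x \<notin> L \<Longrightarrow> g x = 0"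
  shows "g \<in> loj_radical V A \<aa>"
proof -
  have ideal: "ideal \<aa> (smooth_ring V A)" using \<aa> by (simp add: lojasiewicz_ideal_def)
  have sm: "smooth UNIV g" and zero: "\<And>z. z \<in> zero_set \<aa> \<Longrightarrow> g z = 0"
    using g by (auto simp: vanishing_ideal_def smooth_ring_simps)
  obtain f where f: "f \<in> \<aa>" "\<forall>K. compact K \<longrightarrow> (\<exists>c>0. \<exists>m::nat. m \<ge> 1 \<and>
      (\<exists>N. open N \<and> K \<subseteq> N \<and> (\<forall>x\<in>N. \<bar>f x\<bar> \<ge> c * dist_to x (zero_set \<aa>) ^ m)))"
    using \<aa> unfolding lojasiewicz_ideal_def by blast
  obtain c m where cm: "c > 0" "m \<ge> 1" "\<And>x. x \<in> L \<Longrightarrow> c * dist_to x (zero_set \<aa>) ^ m \<le> \<bar>f x\<bar>"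
    using f(2) L(1) by (metis subsetD)
  obtain C where C: "C \<ge> 0" "\<And>x. x \<in> L \<Longrightarrow> \<bar>g x\<bar> \<le> C * dist_to x (zero_set \<aa>)"
    using vanishing_le_dist_on_compact[OF sm zero L(1)] by metis
  define k where "k = (C ^ m / c)\<^sup>2"
  have bound: "g x ^ (2 * m) \<le> k * f x * f x" for x
  proof (cases "x \<in> L")
    case True
    let ?d = "dist_to x (zero_set \<aa>)"
    have "\<bar>g x\<bar> ^ m \<le> (C * ?d) ^ m" by (rule power_mono[OF C(2)[OF True]]) simp
    also have "\<dots> = C ^ m / c * (c * ?d ^ m)" using cm(1) by (simp add: power_mult_distrib)
    also have "\<dots> \<le> C ^ m / c * \<bar>f x\<bar>"
      using cm(1) C(1) by (intro mult_left_mono cm(3)[OF True]) simp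
    finally have "(\<bar>g x\<bar> ^ m)\<^sup>2 \<le> (C ^ m / c * \<bar>f x\<bar>)\<^sup>2" by (rule power_mono) simp
    also have "\<dots> = k * f x * f x"
      by (simp add: k_def power_mult_distrib power2_eq_square)
    finally show ?thesis by (simp add: power_mult[symmetric] power_even_abs mult.commute)
  next
    case False
    have "0 \<le> k * (f x * f x)" by (simp add: k_def)
    then show ?thesis using L(2)[OF False] cm(2) by (simp add: power_0_left mult.assoc)
  qed
  have "(\<lambda>x. k * f x * f x) \<in> \<aa>"
    using smooth_ideal_smooth[OF ideal f(1)]
    by (intro smooth_ideal_mult[OF ideal _ f(1)] smooth_mult smooth_const) auto
  then show ?thesis
    using sm bound cm(2) unfolding loj_radical_def smooth_ring_simps by fastforce
qed

lemma loj_radical_agrees_near_compact: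
  assumes \<aa>: "lojasiewicz_ideal V A \<aa>" and g: "g \<in> vanishing_ideal V A (zero_set \<aa>)"
    and K: "compact K"
  shows "\<exists>h\<in>loj_radical V A \<aa>. \<exists>W. open W \<and> K \<subseteq> W \<and> (\<forall>x\<in>W. h x = g x)"
proof -
  obtain \<kappa> L W where \<kappa>: "smooth UNIV \<kappa>" "compact L" "\<forall>x. x \<notin> L \<longrightarrow> \<kappa> x = 0"
    "open W" "K \<subseteq> W" "\<forall>x\<in>W. \<kappa> x = 1"
    using cutoff[OF K] .
  have "(\<lambda>x. \<kappa> x * g x) \<in> loj_radical V A \<aa>"
    by (rule vanishing_compact_support_in_loj_radical[OF \<aa> _ \<kappa>(2)])
       (use g \<kappa>(1,3) in \<open>auto simp: vanishing_ideal_def smooth_ring_simps intro!: smooth_mult\<close>)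
  then show ?thesis using \<kappa>(4-6) by (intro bexI[of _ "\<lambda>x. \<kappa> x * g x"] exI[of _ W]) auto
qed

lemma loj_radical_vanishes: "loj_radical V A \<aa> \<subseteq> vanishing_ideal V A (zero_set \<aa>)"
proof
  fix g assume "g \<in> loj_radical V A \<aa>"
  then obtain f m where g: "g \<in> carrier (smooth_ring V A)" and f: "f \<in> \<aa>"
    and le: "\<And>x. g x ^ (2 * m) \<le> f x"
    unfolding loj_radical_def by auto
  have "g z = 0" if "z \<in> zero_set \<aa>" for z
  proof -
    have "f z = 0" using that f unfolding zero_set_def by blast
    then have "(g z ^ m)\<^sup>2 \<le> 0"
      using le[of z] by (simp add: power_mult[symmetric] mult.commute)
    then show ?thesis by simp
  qed
  then show "g \<in> vanishing_ideal V A (zero_set \<aa>)"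
    using g by (simp add: vanishing_ideal_def)
qed

end

theorem theorem8:
  fixes V :: "'b::euclidean_space set"
    and A :: "('a::{metric_space, second_countable_topology}, 'b) chart set"
    and \<aa> :: "('a \<Rightarrow> real) set"
  assumes "smooth_atlas V A"
    and "locally_euclidean_dist A"
    and "lojasiewicz_ideal V A \<aa>"
  shows "analytic_like V A (loj_radical V A \<aa>) \<and>
         saturation V A (loj_radical V A \<aa>) =
           smooth_topology V A closure_of loj_radical V A \<aa> \<and>
         vanishing_ideal V A (zero_set \<aa>) =
           smooth_topology V A closure_of loj_radical V A \<aa>"
proof -
  interpret metric_manifold V A by unfold_locales fact+
  have "ideal (loj_radical V A \<aa>) (smooth_ring V A)"
    using loj_radical_ideal assms(3) by (simp add: lojasiewicz_ideal_def)
  then show ?thesis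
    unfolding analytic_like_def
    using saturation_eq_vanishing_ideal[OF loj_radical_vanishes loj_radical_agrees_near_compact[OF assms(3)]]
      whitney_closure_eq_vanishing_ideal[OF loj_radical_vanishes loj_radical_agrees_near_compact[OF assms(3)]]
      smooth_closure_eq_vanishing_ideal[OF loj_radical_vanishes loj_radical_agrees_near_compact[OF assms(3)]]
    by simp
qed

end
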